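(* Let $p$ be a prime. (i) Let $n\ge 2$ and let $(G_n,\circ)$ be the group of polynomial permutations of $\mathbb{Z}_{p^n}$ with respect to composition. There are exactly $(p-1)!\,(p-1)^{p-2}$ Sylow $p$-subgroups of $G_n$. They are the inverse images of the Sylow $p$-subgroups of $H$ under the canonical projection $\pi\colon G_n\to H$, $\pi=\theta\circ\pi_2\circ\cdots\circ\pi_{n-1}$. (ii) Let $G=\varprojlim G_n$. There are exactly $(p-1)!\,(p-1)^{p-2}$ Sylow $p$-subgroups of $G$, and they are the inverse images of the Sylow $p$-subgroups of $H$ under the canonical projection $\pi\colon G\to H$. Here the Sylow $p$-subgroups of $H$ are the groups $$S_{(C,\bar\varphi)}=\Big\{(f,f')\in H \;\Big|\; f\in C,\ f'(x)=\frac{\varphi(f(x))}{\varphi(x)}\ \text{for all } x\in\mathbb{Z}_p\Big\},$$ where $C$ ranges over the cyclic subgroups of order $p$ of $S_p$, $\varphi$ over the functions $\mathbb{Z}_p\to\mathbb{Z}_p\setminus\{0\}$, and $\bar\varphi$ is the class of $\varphi$ modulo multiplication by a non-zero constant.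
   Context: $p$ is a fixed prime and $\mathbb{Z}_{p^n}=\mathbb{Z}/p^n\mathbb{Z}$ (integers mod $p^n$). $S_p$ is the symmetric group on the $p$ elements of $\mathbb{Z}_p$. For $f\in\mathbb{Z}[x]$, $[f]_{p^n}$ denotes the function $\mathbb{Z}_{p^n}\to\mathbb{Z}_{p^n}$ induced by $f$. A polynomial permutation of $\mathbb{Z}_{p^n}$ is a bijection of the form $[f]_{p^n}$ with $f\in\mathbb{Z}[x]$; $(G_n,\circ)$ is the group of these under composition. $\pi_n\colon G_{n+1}\to G_n$ is the canonical map $[f]_{p^{n+1}}\mapsto[f]_{p^n}$. $(E,\circ)$ is the monoid of all pairs $(f,f')$ of arbitrary functions $f,f'\colon\mathbb{Z}_p\to\mathbb{Z}_p$ (here $f'$ is just a symbol for a second function), with composition $(f,f')\circ(g,g')=(f\circ g,\ (f'\circ g)\cdot g')$, where $((f'\circ g)\cdot g')(x)=f'(g(x))\cdot g'(x)$. $H$ is the group of units of $E$; explicitly, it consists of the pairs with $f$ bijective and $f'$ nowhere zero. $\theta\colon G_2\to H$ is the (well-defined) homomorphism $\theta([g]_{p^2})=([g]_p,[g']_p)$, where in $[g']_p$ the $g'$ is the formal derivative of the polynomial $g$; $\psi\colon H\to G_1$ is $\psi(f,f')=f$. For $n=2$, the map $\pi$ in (i) is $\theta$. $G=\varprojlim G_n$ is the projective limit of the system $G_1\xleftarrow{\psi}H\xleftarrow{\theta}G_2\xleftarrow{\pi_2}G_3\xleftarrow{\pi_3}\cdots$. A Sylow $p$-subgroup of the profinite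 group $G$ is a maximal subgroup among those consisting of elements whose image in each of the finite groups of the projective system has order a power of $p$. *)

theory Defs
  imports
    "HOL-Algebra.Bij"
    "HOL-Algebra.Product_Groups"
    "HOL-Algebra.Elementary_Groups"
    "HOL-Algebra.Multiplicative_Group"
    "HOL-Number_Theory.Residues"
    "HOL-Computational_Algebra.Polynomial"
begin

section \<open>Polynomial permutations of the integers modulo a prime power\<close>

text \<open>
  Maps between residue rings are extensional functions, so that equality of maps
  is equality in HOL.
\<close>

abbreviation Zmod :: "nat \<Rightarrow> nat \<Rightarrow> int ring" where
  "Zmod p n \<equiv> residue_ring (int (p ^ n))"

abbreviation Zp :: "nat \<Rightarrow> int ring" where
  "Zp p \<equiv> residue_ring (int p)"

definition poly_map :: "nat \<Rightarrow> nat \<Rightarrow> int poly \<Rightarrow> int \<Rightarrow> int" where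
  "poly_map p n f = (\<lambda>x \<in> carrier (Zmod p n). poly f x mod int (p ^ n))"

definition poly_perm_group :: "nat \<Rightarrow> nat \<Rightarrow> (int \<Rightarrow> int) monoid" where
  "poly_perm_group p n =
     (BijGroup (carrier (Zmod p n)))
       \<lparr>carrier := {F \<in> carrier (BijGroup (carrier (Zmod p n))). \<exists>f. F = poly_map p n f}\<rparr>"

definition proj_step :: "nat \<Rightarrow> nat \<Rightarrow> (int \<Rightarrow> int) \<Rightarrow> (int \<Rightarrow> int)" where
  "proj_step p n F = (THE F'. \<exists>f. F = poly_map p (Suc n) f \<and> F' = poly_map p n f)"

section \<open>The monoid of pairs of functions and its group of units\<close>

definition pair_monoid :: "nat \<Rightarrow> ((int \<Rightarrow> int) \<times> (int \<Rightarrow> int)) monoid" where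
  "pair_monoid p =
     \<lparr>carrier = (carrier (Zp p) \<rightarrow>\<^sub>E carrier (Zp p)) \<times> (carrier (Zp p) \<rightarrow>\<^sub>E carrier (Zp p)),
      monoid.mult = (\<lambda>(f, f') (g, g').
        (compose (carrier (Zp p)) f g,
         \<lambda>x \<in> carrier (Zp p). f' (g x) \<otimes>\<^bsub>Zp p\<^esub> g' x)),
      one = (\<lambda>x \<in> carrier (Zp p). x, \<lambda>x \<in> carrier (Zp p). \<one>\<^bsub>Zp p\<^esub>)\<rparr>"

definition pair_group :: "nat \<Rightarrow> ((int \<Rightarrow> int) \<times> (int \<Rightarrow> int)) monoid" where
  "pair_group p = units_of (pair_monoid p)"

definition theta :: "nat \<Rightarrow> (int \<Rightarrow> int) \<Rightarrow> (int \<Rightarrow> int) \<times> (int \<Rightarrow> int)" where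
  "theta p F =
     (THE h. \<exists>g. F = poly_map p 2 g \<and> h = (poly_map p 1 g, poly_map p 1 (pderiv g)))"

definition psi :: "(int \<Rightarrow> int) \<times> (int \<Rightarrow> int) \<Rightarrow> (int \<Rightarrow> int)" where
  "psi h = fst h"

definition proj_pair :: "nat \<Rightarrow> nat \<Rightarrow> (int \<Rightarrow> int) \<Rightarrow> (int \<Rightarrow> int) \<times> (int \<Rightarrow> int)" where
  "proj_pair p n = theta p \<circ> foldr (\<circ>) (map (proj_step p) [2..<n]) id"

section \<open>The projective limit\<close>

text \<open>
  A point of the limit is a triple: its components in the polynomial permutation group
  modulo \<open>p\<close>, in the group of pairs, and, as a family indexed by \<open>n \<ge> 2\<close>, in the
  polynomial permutation groups modulo \<open>p ^ n\<close>.
\<close>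

definition limit_group ::
  "nat \<Rightarrow> ((int \<Rightarrow> int) \<times> ((int \<Rightarrow> int) \<times> (int \<Rightarrow> int)) \<times> (nat \<Rightarrow> int \<Rightarrow> int)) monoid" where
  "limit_group p =
     (let P = poly_perm_group p 1 \<times>\<times> pair_group p \<times>\<times> product_group {2..} (poly_perm_group p)
      in P \<lparr>carrier := {(a, h, g) \<in> carrier P.
              psi h = a \<and> theta p (g 2) = h \<and> (\<forall>n\<ge>2. proj_step p n (g (Suc n)) = g n)}\<rparr>)"

definition limit_proj_pair ::
  "(int \<Rightarrow> int) \<times> ((int \<Rightarrow> int) \<times> (int \<Rightarrow> int)) \<times> (nat \<Rightarrow> int \<Rightarrow> int)
     \<Rightarrow> (int \<Rightarrow> int) \<times> (int \<Rightarrow> int)" where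
  "limit_proj_pair z = fst (snd z)"

section \<open>Sylow subgroups\<close>

definition p_power_order :: "nat \<Rightarrow> ('a, 'b) monoid_scheme \<Rightarrow> 'a \<Rightarrow> bool" where
  "p_power_order p G x \<longleftrightarrow> (\<exists>k. group.ord G x = p ^ k)"

definition p_subgroup :: "nat \<Rightarrow> ('a, 'b) monoid_scheme \<Rightarrow> 'a set \<Rightarrow> bool" where
  "p_subgroup p G P \<longleftrightarrow> subgroup P G \<and> (\<forall>x\<in>P. p_power_order p G x)"

definition sylow_subgroup :: "nat \<Rightarrow> ('a, 'b) monoid_scheme \<Rightarrow> 'a set \<Rightarrow> bool" where
  "sylow_subgroup p G P \<longleftrightarrow>
     p_subgroup p G P \<and> (\<forall>Q. p_subgroup p G Q \<and> P \<subseteq> Q \<longrightarrow> Q = P)"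

definition limit_p_subgroup ::
  "nat \<Rightarrow> ((int \<Rightarrow> int) \<times> ((int \<Rightarrow> int) \<times> (int \<Rightarrow> int)) \<times> (nat \<Rightarrow> int \<Rightarrow> int)) set \<Rightarrow> bool" where
  "limit_p_subgroup p P \<longleftrightarrow>
     subgroup P (limit_group p) \<and>
     (\<forall>(a, h, g) \<in> P.
        p_power_order p (poly_perm_group p 1) a \<and>
        p_power_order p (pair_group p) h \<and>
        (\<forall>n\<ge>2. p_power_order p (poly_perm_group p n) (g n)))"

definition limit_sylow_subgroup ::
  "nat \<Rightarrow> ((int \<Rightarrow> int) \<times> ((int \<Rightarrow> int) \<times> (int \<Rightarrow> int)) \<times> (nat \<Rightarrow> int \<Rightarrow> int)) set \<Rightarrow> bool" where
  "limit_sylow_subgroup p P \<longleftrightarrow>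
     limit_p_subgroup p P \<and> (\<forall>Q. limit_p_subgroup p Q \<and> P \<subseteq> Q \<longrightarrow> Q = P)"

section \<open>The explicit subgroups of the group of pairs\<close>

definition order_p_cyclic_subgroups :: "nat \<Rightarrow> (int \<Rightarrow> int) set set" where
  "order_p_cyclic_subgroups p =
     {C. subgroup C (BijGroup (carrier (Zp p))) \<and>
         cyclic_group ((BijGroup (carrier (Zp p)))\<lparr>carrier := C\<rparr>) \<and> card C = p}"

definition nonzero_maps :: "nat \<Rightarrow> (int \<Rightarrow> int) set" where
  "nonzero_maps p = carrier (Zp p) \<rightarrow>\<^sub>E (carrier (Zp p) - {\<zero>\<^bsub>Zp p\<^esub>})"

definition scalar_rel :: "nat \<Rightarrow> ((int \<Rightarrow> int) \<times> (int \<Rightarrow> int)) set" where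
  "scalar_rel p =
     {(\<phi>, \<chi>) \<in> nonzero_maps p \<times> nonzero_maps p.
        \<exists>c \<in> carrier (Zp p) - {\<zero>\<^bsub>Zp p\<^esub>}. \<chi> = (\<lambda>x \<in> carrier (Zp p). c \<otimes>\<^bsub>Zp p\<^esub> \<phi> x)}"

definition explicit_sylow ::
  "nat \<Rightarrow> (int \<Rightarrow> int) set \<Rightarrow> (int \<Rightarrow> int) set \<Rightarrow> ((int \<Rightarrow> int) \<times> (int \<Rightarrow> int)) set" where
  "explicit_sylow p C \<Phi> =
     {(f, f') \<in> carrier (pair_group p). f \<in> C \<and>
        (\<exists>\<phi>\<in>\<Phi>. \<forall>x \<in> carrier (Zp p). f' x = \<phi> (f x) \<otimes>\<^bsub>Zp p\<^esub> inv\<^bsub>Zp p\<^esub> (\<phi> x))}"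

section \<open>The choices in the definitions above are immaterial\<close>

lemma poly_mod_cong:
  fixes f :: "int poly"
  assumes "x mod m = y mod m"
  shows "poly f x mod m = poly f y mod m"
proof (induction f)
  case 0
  show ?case by simp
next
  case (pCons a f)
  have "(x * poly f x) mod m = (y * poly f y) mod m"
    using assms pCons.IH by (metis mod_mult_eq)
  then show ?case
    by (simp, metis mod_add_right_eq)
qed

lemma poly_map_eq_iff:
  assumes "p > 0"
  shows "poly_map p n f = poly_map p n g \<longleftrightarrow> (\<forall>x. poly f x mod int (p ^ n) = poly g x mod int (p ^ n))"
    (is "?L \<longleftrightarrow> ?R")
proof
  assume L: ?L
  show ?R
  proof
    fix x :: int
    define y where "y = x mod int (p ^ n)"
    have y: "y \<in> carrier (Zmod p n)" "y mod int (p ^ n) = x mod int (p ^ n)"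
      using assms by (auto simp: y_def residue_ring_def)
    have "poly f y mod int (p ^ n) = poly g y mod int (p ^ n)"
      using fun_cong[OF L, of y] y(1) by (simp add: poly_map_def)
    then show "poly f x mod int (p ^ n) = poly g x mod int (p ^ n)"
      using poly_mod_cong[OF y(2)] by metis
  qed
next
  assume ?R
  then show ?L by (simp add: poly_map_def)
qed

lemma poly_map_le:
  assumes "p > 0" "m \<le> n" "poly_map p n f = poly_map p n g"
  shows "poly_map p m f = poly_map p m g"
proof -
  have "int (p ^ m) dvd int (p ^ n)"
    using assms(2) by (simp add: le_imp_power_dvd)
  then show ?thesis
    using assms(1,3) unfolding poly_map_eq_iff[OF assms(1)]
    by (metis mod_mod_cancel)
qed

lemma proj_step_poly_map:
  assumes "p > 0"
  shows "proj_step p n (poly_map p (Suc n) f) = poly_map p n f"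
  unfolding proj_step_def
proof (rule the_equality)
  show "\<exists>g. poly_map p (Suc n) f = poly_map p (Suc n) g \<and> poly_map p n f = poly_map p n g"
    by blast
next
  fix F' assume "\<exists>g. poly_map p (Suc n) f = poly_map p (Suc n) g \<and> F' = poly_map p n g"
  then obtain g where g: "poly_map p (Suc n) f = poly_map p (Suc n) g" "F' = poly_map p n g"
    by blast
  have "poly_map p n f = poly_map p n g"
    by (rule poly_map_le[OF assms _ g(1)]) simp
  then show "F' = poly_map p n f"
    using g(2) by simp
qed

lemma poly_taylor:
  fixes f :: "int poly"
  shows "\<exists>c. poly f (x + t) = poly f x + t * poly (pderiv f) x + t * t * c"
proof (induction f)
  case 0
  show ?case by simp
next
  case (pCons a f)
  then obtain c where c: "poly f (x + t) = poly f x + t * poly (pderiv f) x + t * t * c"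
    by blast
  have "poly (pCons a f) (x + t) = a + (x + t) * (poly f x + t * poly (pderiv f) x + t * t * c)"
    unfolding c[symmetric] by simp
  also have "\<dots> = poly (pCons a f) x + t * poly (pderiv (pCons a f)) x
      + t * t * (poly (pderiv f) x + x * c + t * c)"
    by (simp add: pderiv_pCons algebra_simps)
  finally show ?case by blast
qed

lemma poly_map_pderiv:
  assumes "p > 0" "poly_map p 2 f = poly_map p 2 g"
  shows "poly_map p 1 (pderiv f) = poly_map p 1 (pderiv g)"
proof -
  define h where "h = f - g"
  have *: "int p * int p dvd poly h x" for x
    using assms(2) unfolding poly_map_eq_iff[OF assms(1)]
    by (simp add: h_def mod_eq_dvd_iff power2_eq_square)
  have "int p dvd poly (pderiv h) x" for x
  proof -
    obtain c where "poly h (x + int p) = poly h x + int p * poly (pderiv h) x + int p * int p * c"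
      using poly_taylor by blast
    then have "int p * poly (pderiv h) x = poly h (x + int p) - poly h x - int p * int p * c"
      by simp
    then have "int p * int p dvd int p * poly (pderiv h) x"
      using * by simp
    then show ?thesis using assms(1) by simp
  qed
  then show ?thesis
    unfolding poly_map_eq_iff[OF assms(1)]
    by (simp add: h_def mod_eq_dvd_iff pderiv_diff)
qed

lemma theta_poly_map:
  assumes "p > 0"
  shows "theta p (poly_map p 2 g) = (poly_map p 1 g, poly_map p 1 (pderiv g))"
  unfolding theta_def
proof (rule the_equality)
  show "\<exists>f. poly_map p 2 g = poly_map p 2 f \<and>
          (poly_map p 1 g, poly_map p 1 (pderiv g)) = (poly_map p 1 f, poly_map p 1 (pderiv f))"
    by blast
next
  fix h
  assume "\<exists>f. poly_map p 2 g = poly_map p 2 f \<and> h = (poly_map p 1 f, poly_map p 1 (pderiv f))"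
  then obtain f where f: "poly_map p 2 g = poly_map p 2 f" "h = (poly_map p 1 f, poly_map p 1 (pderiv f))"
    by blast
  have "poly_map p 1 g = poly_map p 1 f"
    by (rule poly_map_le[OF assms _ f(1)]) simp
  with f poly_map_pderiv[OF assms f(1)] show "h = (poly_map p 1 g, poly_map p 1 (pderiv g))"
    by simp
qed

lemma scalar_ratio:
  assumes "prime p" "c \<in> carrier (Zp p) - {\<zero>\<^bsub>Zp p\<^esub>}"
    and "a \<in> carrier (Zp p)" "b \<in> carrier (Zp p) - {\<zero>\<^bsub>Zp p\<^esub>}"
  shows "(c \<otimes>\<^bsub>Zp p\<^esub> a) \<otimes>\<^bsub>Zp p\<^esub> inv\<^bsub>Zp p\<^esub> (c \<otimes>\<^bsub>Zp p\<^esub> b) = a \<otimes>\<^bsub>Zp p\<^esub> inv\<^bsub>Zp p\<^esub> b"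
proof -
  interpret residues_prime p "Zp p"
    using assms(1) by unfold_locales simp_all
  interpret field "Zp p" by (rule is_field)
  have cu: "c \<in> Units (Zp p)" and bu: "b \<in> Units (Zp p)"
    using assms field_Units by auto
  have cc: "c \<in> carrier (Zp p)" "b \<in> carrier (Zp p)"
    "inv\<^bsub>Zp p\<^esub> c \<in> carrier (Zp p)" "inv\<^bsub>Zp p\<^esub> b \<in> carrier (Zp p)"
    using assms cu bu by auto
  have "inv\<^bsub>Zp p\<^esub> (c \<otimes>\<^bsub>Zp p\<^esub> b) = inv\<^bsub>Zp p\<^esub> b \<otimes>\<^bsub>Zp p\<^esub> inv\<^bsub>Zp p\<^esub> c"
  proof (rule comm_inv_char)
    have "(c \<otimes>\<^bsub>Zp p\<^esub> b) \<otimes>\<^bsub>Zp p\<^esub> (inv\<^bsub>Zp p\<^esub> b \<otimes>\<^bsub>Zp p\<^esub> inv\<^bsub>Zp p\<^esub> c)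
        = (c \<otimes>\<^bsub>Zp p\<^esub> inv\<^bsub>Zp p\<^esub> c) \<otimes>\<^bsub>Zp p\<^esub> (b \<otimes>\<^bsub>Zp p\<^esub> inv\<^bsub>Zp p\<^esub> b)"
      using cc by (simp add: m_ac del: Units_r_inv)
    then show "(c \<otimes>\<^bsub>Zp p\<^esub> b) \<otimes>\<^bsub>Zp p\<^esub> (inv\<^bsub>Zp p\<^esub> b \<otimes>\<^bsub>Zp p\<^esub> inv\<^bsub>Zp p\<^esub> c) = \<one>\<^bsub>Zp p\<^esub>"
      using cu bu by simp
  qed (use cc in auto)
  then have "(c \<otimes>\<^bsub>Zp p\<^esub> a) \<otimes>\<^bsub>Zp p\<^esub> inv\<^bsub>Zp p\<^esub> (c \<otimes>\<^bsub>Zp p\<^esub> b)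
      = (c \<otimes>\<^bsub>Zp p\<^esub> inv\<^bsub>Zp p\<^esub> c) \<otimes>\<^bsub>Zp p\<^esub> (a \<otimes>\<^bsub>Zp p\<^esub> inv\<^bsub>Zp p\<^esub> b)"
    using cc assms(3) by (simp add: m_ac)
  then show ?thesis
    using cu cc assms(3) by simp
qed

lemma pair_group_carrier_imp:
  assumes "(f, f') \<in> carrier (pair_group p)"
  shows "f \<in> carrier (Zp p) \<rightarrow>\<^sub>E carrier (Zp p)" "f' \<in> carrier (Zp p) \<rightarrow>\<^sub>E carrier (Zp p)"
  using assms by (auto simp: pair_group_def units_of_def Units_def pair_monoid_def)

lemma explicit_sylow_class:
  assumes "prime p" "\<phi> \<in> nonzero_maps p"
  shows "explicit_sylow p C (scalar_rel p `` {\<phi>}) =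
    {(f, f') \<in> carrier (pair_group p). f \<in> C \<and>
        (\<forall>x \<in> carrier (Zp p). f' x = \<phi> (f x) \<otimes>\<^bsub>Zp p\<^esub> inv\<^bsub>Zp p\<^esub> (\<phi> x))}"
proof -
  interpret residues_prime p "Zp p"
    using assms(1) by unfold_locales simp_all
  interpret field "Zp p" by (rule is_field)
  let ?Z = "carrier (Zp p)"
  have nz: "\<phi> x \<in> ?Z - {\<zero>\<^bsub>Zp p\<^esub>}" if "x \<in> ?Z" for x
    using assms(2) that unfolding nonzero_maps_def by (rule PiE_mem)
  have one: "(\<lambda>x \<in> ?Z. \<one>\<^bsub>Zp p\<^esub> \<otimes>\<^bsub>Zp p\<^esub> \<phi> x) = \<phi>"
  proof
    fix x
    show "(\<lambda>x \<in> ?Z. \<one>\<^bsub>Zp p\<^esub> \<otimes>\<^bsub>Zp p\<^esub> \<phi> x) x = \<phi> x"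
    proof (cases "x \<in> ?Z")
      case True
      then show ?thesis using nz[OF True] by (metis DiffD1 l_one restrict_apply')
    next
      case False
      then show ?thesis
        using PiE_arb[OF assms(2)[unfolded nonzero_maps_def] False] by simp
    qed
  qed
  have "\<one>\<^bsub>Zp p\<^esub> \<in> ?Z - {\<zero>\<^bsub>Zp p\<^esub>}"
    using one_closed one_not_zero by blast
  then have refl: "\<phi> \<in> scalar_rel p `` {\<phi>}"
    unfolding scalar_rel_def using assms(2)
    by (simp del: One_nat_def, intro bexI[of _ "\<one>\<^bsub>Zp p\<^esub>"], intro one[symmetric], simp)
  have ratio: "\<chi> (f x) \<otimes>\<^bsub>Zp p\<^esub> inv\<^bsub>Zp p\<^esub> (\<chi> x) = \<phi> (f x) \<otimes>\<^bsub>Zp p\<^esub> inv\<^bsub>Zp p\<^esub> (\<phi> x)"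
    if asm: "(f, f') \<in> carrier (pair_group p)" "\<chi> \<in> scalar_rel p `` {\<phi>}" "x \<in> ?Z" for f f' \<chi> x
  proof -
    obtain c where c: "c \<in> ?Z - {\<zero>\<^bsub>Zp p\<^esub>}" "\<chi> = (\<lambda>x \<in> ?Z. c \<otimes>\<^bsub>Zp p\<^esub> \<phi> x)"
      using asm(2) by (auto simp: scalar_rel_def)
    have fx: "f x \<in> ?Z"
      using pair_group_carrier_imp(1)[OF asm(1)] asm(3) by (rule PiE_mem)
    show ?thesis
      using scalar_ratio[OF assms(1) c(1) _ nz[OF asm(3)], of "\<phi> (f x)"] nz[OF fx] fx asm(3)
      by (simp add: c(2))
  qed
  have *: "(\<exists>\<chi>\<in>scalar_rel p `` {\<phi>}. \<forall>x \<in> ?Z. f' x = \<chi> (f x) \<otimes>\<^bsub>Zp p\<^esub> inv\<^bsub>Zp p\<^esub> (\<chi> x))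
      \<longleftrightarrow> (\<forall>x \<in> ?Z. f' x = \<phi> (f x) \<otimes>\<^bsub>Zp p\<^esub> inv\<^bsub>Zp p\<^esub> (\<phi> x))"
    if "(f, f') \<in> carrier (pair_group p)" for f f'
    using refl ratio[OF that] by (metis (no_types, lifting))
  show ?thesis
    unfolding explicit_sylow_def by (rule Collect_cong) (use * in blast)
qed

end

theory Submission
  imports Defs "HOL-Combinatorics.Permutations"
begin

text \<open>
  Two facts about the projection from polynomial permutations to pairs reduce everything to the
  finite group \<open>H\<close> of pairs. It is onto (\<open>ex_poly_of_pair\<close>): for any two functions on the
  residues modulo \<open>p\<close> some integer polynomial induces the first while its derivative induces the
  second, since adding a multiple of \<open>x ^ p - x\<close> changes the derivative but not the function; and a
  polynomial that permutes the residues modulo \<open>p\<close> and has nowhere vanishing derivative permutes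
  the residues modulo every power of \<open>p\<close> (\<open>poly_map_in_poly_perm_group_iff\<close>). Its kernel consists of
  elements of \<open>p\<close>-power order (\<open>kernel_proj_pair_p_power_order\<close>): if \<open>h\<close> is congruent to the identity
  modulo \<open>p ^ m\<close> and its derivative to \<open>1\<close> modulo \<open>p\<close>, then \<open>h\<close> acts to first order as a
  translation, and its \<open>p\<close>-th iterate is the identity modulo \<open>p ^ (m + 1)\<close>. Hence an element
  has \<open>p\<close>-power order iff its image in \<open>H\<close> has, and maximal subgroups of such elements
  correspond to each other under inverse images (\<open>maximal_subgroups_with_preimage\<close>). The same
  reasoning applies to the projective limit, where all components of a point are governed by
  its component in \<open>H\<close>.

  In \<open>H\<close>, an element \<open>(f, f')\<close> of \<open>p\<close>-power order for which \<open>f\<close> has a fixed point is trivial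
  (\<open>pair_p_power_order_fixed_point\<close>): the cycles of \<open>f\<close> have \<open>p\<close>-power length less than \<open>p\<close>, so
  \<open>f\<close> is the identity, and the values of \<open>f'\<close> are then roots of unity of \<open>p\<close>-power order in a
  field of characteristic \<open>p\<close>. So a \<open>p\<close>-subgroup acts freely on the \<open>p\<close> residues, and is trivial
  or simply transitive of order \<open>p\<close>. The Sylow subgroups of \<open>H\<close> are thus its subgroups of
  order \<open>p\<close>.

  Let \<open>P\<close> be such a subgroup and \<open>q\<^sub>y\<close> its unique element taking \<open>0\<close> to \<open>y\<close>. The function
  \<open>\<phi> y = snd q\<^sub>y 0\<close> exhibits \<open>P\<close> as an explicit subgroup (\<open>card_p_subgroup_is_cocycle_subgroup\<close>),
  because \<open>q \<circ> q\<^sub>x\<close> takes \<open>0\<close> to \<open>fst q x\<close>, so that \<open>\<phi> (fst q x) = snd q x * \<phi> x\<close>. This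
  \<open>\<phi>\<close> is the representative of its class with \<open>\<phi> 0 = 1\<close>, and it is determined by \<open>P\<close>. Therefore
  the Sylow subgroups are counted by pairs of a permutation group of order \<open>p\<close> and a normalised
  \<open>\<phi>\<close>. There are \<open>(p - 1) ^ (p - 1)\<close> of the latter. A permutation group of order \<open>p\<close> contains exactly one
  permutation with \<open>0 \<mapsto> 1\<close>, a \<open>p\<close>-cycle, and such cycles correspond to the orderings of the
  remaining \<open>p - 2\<close> residues, which gives \<open>(p - 2)!\<close> groups.
\<close>

section \<open>Maximal subgroups and epimorphisms\<close>

text \<open>
  The property \<open>A\<close> is left open because in the projective limit the Sylow condition concerns the
  orders of the components of an element, not its order in the limit, which may be infinite.
\<close>

definition maximal_subgroup_with ::
  "('a \<Rightarrow> bool) \<Rightarrow> ('a, 'b) monoid_scheme \<Rightarrow> 'a set \<Rightarrow> bool" where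
  "maximal_subgroup_with A G P \<longleftrightarrow>
     (subgroup P G \<and> (\<forall>x\<in>P. A x)) \<and>
     (\<forall>Q. (subgroup Q G \<and> (\<forall>x\<in>Q. A x)) \<and> P \<subseteq> Q \<longrightarrow> Q = P)"

lemma (in group_hom) subgroup_preimage:
  assumes "subgroup S H"
  shows "subgroup {x \<in> carrier G. h x \<in> S} G"
proof (rule G.subgroupI)
  have "\<one> \<in> {x \<in> carrier G. h x \<in> S}"
    using subgroup.one_closed[OF assms] by simp
  then show "{x \<in> carrier G. h x \<in> S} \<noteq> {}"
    by blast
qed (use assms in \<open>auto simp: subgroup.m_closed subgroup.m_inv_closed\<close>)

text \<open>
  Passing to the image and then to the inverse image enlarges a subgroup without destroying
  \<open>A\<close>, so a maximal subgroup equals the inverse image of its image; surjectivity makes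
  inverse images determine the subgroups they come from.
\<close>

lemma (in group_hom) maximal_subgroups_with_preimage:
  assumes surj: "h ` carrier G = carrier H"
    and AB: "\<And>x. x \<in> carrier G \<Longrightarrow> A x \<longleftrightarrow> B (h x)"
  shows "{P. maximal_subgroup_with A G P} =
      (\<lambda>S. {x \<in> carrier G. h x \<in> S}) ` {S. maximal_subgroup_with B H S}" (is "?L = ?pre ` ?R")
    and "inj_on (\<lambda>S. {x \<in> carrier G. h x \<in> S}) {S. maximal_subgroup_with B H S}"
proof -
  have img_pre: "h ` ?pre S = S" if "subgroup S H" for S
    using surj subgroup.subset[OF that] by auto
  then show "inj_on ?pre ?R"
    by (intro inj_onI) (metis (mono_tags, lifting) maximal_subgroup_with_def mem_Collect_eq)
  have pre: "subgroup (?pre S) G \<and> (\<forall>x\<in>?pre S. A x)" if "subgroup S H" "\<forall>y\<in>S. B y" for S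
    using subgroup_preimage[OF that(1)] that(2) AB by auto
  have img: "subgroup (h ` P) H \<and> (\<forall>y\<in>h ` P. B y)" if "subgroup P G" "\<forall>x\<in>P. A x" for P
    using subgroup_img_is_subgroup[OF that(1)] that(2) AB subgroup.subset[OF that(1)] by auto
  have sub: "P \<subseteq> ?pre (h ` P)" if "subgroup P G" for P
    using subgroup.subset[OF that] by auto
  show "?L = ?pre ` ?R"
  proof (intro equalityI subsetI)
    fix P assume "P \<in> ?L"
    then have P: "subgroup P G" "\<forall>x\<in>P. A x"
      and max: "\<And>Q. subgroup Q G \<and> (\<forall>x\<in>Q. A x) \<Longrightarrow> P \<subseteq> Q \<Longrightarrow> Q = P"
      unfolding maximal_subgroup_with_def by blast+
    note hP = img[OF P]
    have eq: "P = ?pre (h ` P)"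
      using max[OF pre] sub[OF P(1)] hP by blast
    have "T = h ` P" if "subgroup T H" "\<forall>y\<in>T. B y" "h ` P \<subseteq> T" for T
    proof -
      have "?pre T = P"
        using max[OF pre[OF that(1,2)]] that(3) sub[OF P(1)] by blast
      then show ?thesis
        using img_pre[OF that(1)] by blast
    qed
    then have "h ` P \<in> ?R"
      using hP unfolding maximal_subgroup_with_def by blast
    then show "P \<in> ?pre ` ?R"
      using eq by blast
  next
    fix P assume "P \<in> ?pre ` ?R"
    then obtain S where P: "P = ?pre S" and mS: "maximal_subgroup_with B H S"
      by blast
    from mS have S: "subgroup S H" "\<forall>y\<in>S. B y"
      and max: "\<And>Q. subgroup Q H \<and> (\<forall>x\<in>Q. B x) \<Longrightarrow> S \<subseteq> Q \<Longrightarrow> Q = S"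
      unfolding maximal_subgroup_with_def by blast+
    have "Q = P" if Q: "subgroup Q G" "\<forall>x\<in>Q. A x" "P \<subseteq> Q" for Q
    proof -
      have "S \<subseteq> h ` Q"
        using Q(3) img_pre[OF S(1)] unfolding P by blast
      then have "h ` Q = S"
        using max[OF img[OF Q(1,2)]] by blast
      then show ?thesis
        using sub[OF Q(1)] Q(3) unfolding P by blast
    qed
    then show "P \<in> ?L"
      using pre[OF S] unfolding maximal_subgroup_with_def P by blast
  qed
qed

lemma sylow_subgroup_eq_maximal_subgroup_with:
  "sylow_subgroup p G P \<longleftrightarrow> maximal_subgroup_with (p_power_order p G) G P"
  unfolding sylow_subgroup_def p_subgroup_def maximal_subgroup_with_def ..

section \<open>Elements of p-power order\<close>

lemma (in group) p_power_order_iff: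
  assumes "prime p" "x \<in> carrier G"
  shows "p_power_order p G x \<longleftrightarrow> (\<exists>k. x [^] (p ^ k :: nat) = \<one>)"
proof
  assume "p_power_order p G x"
  then show "\<exists>k. x [^] (p ^ k :: nat) = \<one>"
    unfolding p_power_order_def using pow_ord_eq_1[OF assms(2)] by metis
next
  assume "\<exists>k. x [^] (p ^ k :: nat) = \<one>"
  then obtain k where "ord x dvd p ^ k"
    using pow_eq_id[OF assms(2)] by blast
  then show "p_power_order p G x"
    unfolding p_power_order_def using divides_primepow_nat[OF assms(1)] by blast
qed

text \<open>
  If the image of \<open>x\<close> has \<open>p\<close>-power order, then some \<open>x ^ (p ^ k)\<close> lies in the kernel, where a
  further \<open>p\<close>-power kills it.
\<close>

lemma (in group_hom) p_power_order_hom_iff: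
  assumes p: "prime p"
    and ker: "\<And>x. x \<in> carrier G \<Longrightarrow> h x = \<one>\<^bsub>H\<^esub> \<Longrightarrow> p_power_order p G x"
    and x: "x \<in> carrier G"
  shows "p_power_order p G x \<longleftrightarrow> p_power_order p H (h x)"
proof
  assume "p_power_order p G x"
  then obtain k where "x [^] (p ^ k) = \<one>"
    using G.p_power_order_iff[OF p x] by blast
  then have "h x [^]\<^bsub>H\<^esub> (p ^ k) = \<one>\<^bsub>H\<^esub>"
    using x by (metis hom_nat_pow hom_one)
  then show "p_power_order p H (h x)"
    using H.p_power_order_iff[OF p] x by auto
next
  assume "p_power_order p H (h x)"
  then obtain k where "h x [^]\<^bsub>H\<^esub> (p ^ k) = \<one>\<^bsub>H\<^esub>"
    using H.p_power_order_iff[OF p hom_closed[OF x]] by blast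
  then have "h (x [^] (p ^ k)) = \<one>\<^bsub>H\<^esub>"
    using x by (simp add: hom_nat_pow)
  then have "p_power_order p G (x [^] (p ^ k))"
    using ker x by simp
  then obtain j where "(x [^] (p ^ k)) [^] (p ^ j) = \<one>"
    using G.p_power_order_iff[OF p] x by (meson G.nat_pow_closed)
  then have "x [^] (p ^ (k + j)) = \<one>"
    using x by (simp add: G.nat_pow_pow power_add)
  then show "p_power_order p G x"
    using G.p_power_order_iff[OF p x] by blast
qed

section \<open>Polynomial permutations modulo prime powers\<close>

lemma carrier_residue_ring: "carrier (residue_ring m) = {0..<m}"
  by (auto simp: residue_ring_def)

lemma poly_map_in_carrier:
  assumes "p > 0"
  shows "poly_map p n f \<in> carrier (Zmod p n) \<rightarrow>\<^sub>E carrier (Zmod p n)"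
  using assms by (auto simp: poly_map_def carrier_residue_ring)

lemma poly_map_compose:
  assumes "p > 0"
  shows "compose (carrier (Zmod p n)) (poly_map p n f) (poly_map p n g) = poly_map p n (pcompose f g)"
proof
  fix x
  show "compose (carrier (Zmod p n)) (poly_map p n f) (poly_map p n g) x = poly_map p n (pcompose f g) x"
  proof (cases "x \<in> carrier (Zmod p n)")
    case True
    then show ?thesis
      using assms poly_mod_cong[of "poly g x mod int p ^ n" "int p ^ n" "poly g x" f]
      by (auto simp: compose_def poly_map_def poly_pcompose carrier_residue_ring)
  qed (auto simp: compose_def poly_map_def)
qed

text \<open>
  On a finite set injectivity and surjectivity are equivalent to bijectivity. The injective form
  suits lifting to higher powers of \<open>p\<close>, the surjective form below suits reduction to lower
  ones.
\<close>

lemma poly_map_in_Bij_iff_inj: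
  assumes "p > 0"
  shows "poly_map p n f \<in> Bij (carrier (Zmod p n)) \<longleftrightarrow>
    (\<forall>x y. int p ^ n dvd poly f x - poly f y \<longrightarrow> int p ^ n dvd x - y)" (is "?L \<longleftrightarrow> ?R")
proof -
  let ?m = "int p ^ n" and ?Z = "carrier (Zmod p n)"
  have m: "?m > 0" using assms by simp
  have maps: "poly_map p n f ` ?Z \<subseteq> ?Z"
    using poly_map_in_carrier[OF assms, of n f] by blast
  have "?L \<longleftrightarrow> inj_on (poly_map p n f) ?Z"
    using endo_inj_surj[OF _ maps]
    by (auto simp: Bij_def bij_betw_def poly_map_def carrier_residue_ring)
  also have "\<dots> \<longleftrightarrow> ?R"
  proof
    assume inj: "inj_on (poly_map p n f) ?Z"
    show ?R
    proof (intro allI impI)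
      fix x y assume "?m dvd poly f x - poly f y"
      then have "poly f x mod ?m = poly f y mod ?m"
        by (simp add: mod_eq_dvd_iff)
      then have "poly f (x mod ?m) mod ?m = poly f (y mod ?m) mod ?m"
        by (metis mod_mod_trivial poly_mod_cong)
      then have "poly_map p n f (x mod ?m) = poly_map p n f (y mod ?m)"
        using m by (simp add: poly_map_def carrier_residue_ring)
      then have "x mod ?m = y mod ?m"
        using inj m by (auto simp: inj_on_def carrier_residue_ring)
      then show "?m dvd x - y"
        by (simp add: mod_eq_dvd_iff)
    qed
  next
    assume R: ?R
    show "inj_on (poly_map p n f) ?Z"
    proof (rule inj_onI)
      fix x y assume xy: "x \<in> ?Z" "y \<in> ?Z" and eq: "poly_map p n f x = poly_map p n f y"
      have "poly f x mod ?m = poly f y mod ?m"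
        using xy eq by (simp add: poly_map_def)
      then have "x mod ?m = y mod ?m"
        using R by (simp add: mod_eq_dvd_iff)
      then show "x = y"
        using xy by (simp add: carrier_residue_ring)
    qed
  qed
  finally show ?thesis .
qed

lemma poly_map_in_Bij_iff_surj:
  assumes "p > 0"
  shows "poly_map p n f \<in> Bij (carrier (Zmod p n)) \<longleftrightarrow> (\<forall>y. \<exists>x. int p ^ n dvd poly f x - y)"
    (is "?L \<longleftrightarrow> ?R")
proof -
  let ?m = "int p ^ n" and ?Z = "carrier (Zmod p n)"
  have m: "?m > 0" using assms by simp
  have maps: "poly_map p n f ` ?Z \<subseteq> ?Z"
    using poly_map_in_carrier[OF assms, of n f] by blast
  have fin: "finite ?Z"
    by (simp add: carrier_residue_ring)
  have "?L \<longleftrightarrow> ?Z \<subseteq> poly_map p n f ` ?Z"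
    using maps eq_card_imp_inj_on[OF fin, of "poly_map p n f"]
    by (auto simp: Bij_def bij_betw_def poly_map_def)
  also have "\<dots> \<longleftrightarrow> ?R"
  proof
    assume surj: "?Z \<subseteq> poly_map p n f ` ?Z"
    show ?R
    proof
      fix y
      have "y mod ?m \<in> ?Z"
        using m by (simp add: carrier_residue_ring)
      then obtain x where "x \<in> ?Z" "y mod ?m = poly_map p n f x"
        using surj by blast
      then have "poly f x mod ?m = y mod ?m"
        by (simp add: poly_map_def)
      then show "\<exists>x. ?m dvd poly f x - y"
        by (auto simp: mod_eq_dvd_iff)
    qed
  next
    assume R: ?R
    show "?Z \<subseteq> poly_map p n f ` ?Z"
    proof
      fix y assume y: "y \<in> ?Z"
      obtain x where "?m dvd poly f x - y"
        using R by blast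
      then have "poly f x mod ?m = y mod ?m"
        by (simp add: mod_eq_dvd_iff)
      then have "poly f (x mod ?m) mod ?m = y"
        using y poly_mod_cong[of "x mod ?m" ?m x f] by (simp add: carrier_residue_ring)
      then have "poly_map p n f (x mod ?m) = y" "x mod ?m \<in> ?Z"
        using m by (auto simp: poly_map_def carrier_residue_ring)
      then show "y \<in> poly_map p n f ` ?Z"
        by blast
    qed
  qed
  finally show ?thesis .
qed

lemma poly_perm_group_carrier:
  "F \<in> carrier (poly_perm_group p n) \<longleftrightarrow>
     F \<in> Bij (carrier (Zmod p n)) \<and> (\<exists>f. F = poly_map p n f)"
  by (simp add: poly_perm_group_def BijGroup_def)

lemma poly_perm_group_mult:
  assumes "p > 0" "poly_map p n f \<in> carrier (poly_perm_group p n)"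
    "poly_map p n g \<in> carrier (poly_perm_group p n)"
  shows "poly_map p n f \<otimes>\<^bsub>poly_perm_group p n\<^esub> poly_map p n g = poly_map p n (pcompose f g)"
  using assms by (simp add: poly_perm_group_def BijGroup_def poly_map_compose del: of_nat_power)

lemma poly_perm_group_one: "\<one>\<^bsub>poly_perm_group p n\<^esub> = poly_map p n [:0, 1:]"
  by (auto simp: poly_perm_group_def BijGroup_def poly_map_def carrier_residue_ring restrict_def fun_eq_iff)

lemma carrier_BijGroup: "carrier (BijGroup S) = Bij S"
  by (simp add: BijGroup_def)

lemma BijGroup_mult: "f \<in> Bij S \<Longrightarrow> g \<in> Bij S \<Longrightarrow> f \<otimes>\<^bsub>BijGroup S\<^esub> g = compose S f g"
  by (simp add: BijGroup_def)

lemma finite_BijGroup: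
  assumes "finite S"
  shows "finite (carrier (BijGroup S))"
proof (rule finite_subset)
  show "carrier (BijGroup S) \<subseteq> S \<rightarrow>\<^sub>E S"
    by (auto simp: BijGroup_def Bij_def bij_betw_def extensional_def PiE_def)
qed (use assms in \<open>simp add: finite_PiE\<close>)

text \<open>
  In a finite group inverses are powers.
\<close>

lemma (in group) finite_submonoid_is_subgroup:
  assumes "finite (carrier G)" "N \<subseteq> carrier G" "\<one> \<in> N"
    and "\<And>x y. x \<in> N \<Longrightarrow> y \<in> N \<Longrightarrow> x \<otimes> y \<in> N"
  shows "subgroup N G"
proof (rule subgroupI)
  fix a assume a: "a \<in> N"
  then have ac: "a \<in> carrier G" using assms(2) by blast
  have pow: "a [^] k \<in> N" for k :: nat
    by (induction k) (use assms a in auto)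
  have "a [^] (ord a - 1) \<otimes> a = a [^] ord a"
    using ord_ge_1[OF assms(1) ac] by (metis Suc_diff_1 less_eq_Suc_le One_nat_def nat_pow_Suc)
  then have "inv a = a [^] (ord a - 1)"
    using ac by (simp add: inv_equality)
  then show "inv a \<in> N"
    using pow by simp
qed (use assms in auto)

lemma group_poly_perm_group:
  assumes "p > 0"
  shows "group (poly_perm_group p n)"
proof -
  interpret B: group "BijGroup (carrier (Zmod p n))"
    by (rule group_BijGroup)
  have "subgroup (carrier (poly_perm_group p n)) (BijGroup (carrier (Zmod p n)))"
  proof (rule B.finite_submonoid_is_subgroup)
    show "\<one>\<^bsub>BijGroup (carrier (Zmod p n))\<^esub> \<in> carrier (poly_perm_group p n)"
      using poly_perm_group_one[of p n] B.one_closed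
      by (auto simp: poly_perm_group_def)
    fix F G assume FG: "F \<in> carrier (poly_perm_group p n)" "G \<in> carrier (poly_perm_group p n)"
    then obtain f g where "F = poly_map p n f" "G = poly_map p n g"
      by (auto simp: poly_perm_group_carrier)
    then have "compose (carrier (Zmod p n)) F G = poly_map p n (pcompose f g)"
      using poly_map_compose[OF assms] by simp
    then show "F \<otimes>\<^bsub>BijGroup (carrier (Zmod p n))\<^esub> G \<in> carrier (poly_perm_group p n)"
      using FG compose_Bij[of F "carrier (Zmod p n)" G]
      by (auto simp: poly_perm_group_carrier BijGroup_def simp del: of_nat_power)
  qed (auto simp: finite_BijGroup carrier_residue_ring poly_perm_group_def)
  then show ?thesis
    using subgroup.subgroup_is_group[OF _ group_BijGroup]
    by (simp add: poly_perm_group_def)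
qed

section \<open>The group of pairs\<close>

lemma nonzero_maps_iff:
  "f \<in> nonzero_maps p \<longleftrightarrow> f \<in> {0..<int p} \<rightarrow>\<^sub>E {0<..<int p}"
proof -
  have "carrier (Zp p) - {\<zero>\<^bsub>Zp p\<^esub>} = {0<..<int p}"
    by (auto simp: residue_ring_def)
  then show ?thesis
    unfolding nonzero_maps_def carrier_residue_ring by simp
qed

lemma pair_monoid_mult:
  "(f, f') \<otimes>\<^bsub>pair_monoid p\<^esub> (g, g') =
     (compose {0..<int p} f g, \<lambda>x\<in>{0..<int p}. f' (g x) * g' x mod int p)"
  by (simp add: pair_monoid_def carrier_residue_ring) (simp add: residue_ring_def)

lemma pair_monoid_one:
  "\<one>\<^bsub>pair_monoid p\<^esub> = (\<lambda>x\<in>{0..<int p}. x, \<lambda>x\<in>{0..<int p}. 1)"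
  by (simp add: pair_monoid_def carrier_residue_ring) (simp add: residue_ring_def)

lemma pair_monoid_carrier:
  "carrier (pair_monoid p) = ({0..<int p} \<rightarrow>\<^sub>E {0..<int p}) \<times> ({0..<int p} \<rightarrow>\<^sub>E {0..<int p})"
  by (simp add: pair_monoid_def carrier_residue_ring)

lemma monoid_pair_monoid:
  assumes "prime p"
  shows "monoid (pair_monoid p)"
proof -
  let ?Z = "{0..<int p}"
  have p: "int p > 1"
    using prime_gt_1_nat[OF assms] by simp
  show ?thesis
  proof
    fix a b assume "a \<in> carrier (pair_monoid p)" "b \<in> carrier (pair_monoid p)"
    then show "a \<otimes>\<^bsub>pair_monoid p\<^esub> b \<in> carrier (pair_monoid p)"
      using p by (cases a; cases b) (auto simp: pair_monoid_carrier pair_monoid_mult compose_def PiE_mem)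
  next
    fix a b c
    assume "a \<in> carrier (pair_monoid p)" "b \<in> carrier (pair_monoid p)" "c \<in> carrier (pair_monoid p)"
    then show "a \<otimes>\<^bsub>pair_monoid p\<^esub> b \<otimes>\<^bsub>pair_monoid p\<^esub> c = a \<otimes>\<^bsub>pair_monoid p\<^esub> (b \<otimes>\<^bsub>pair_monoid p\<^esub> c)"
      by (cases a; cases b; cases c)
        (auto simp: pair_monoid_carrier pair_monoid_mult compose_def fun_eq_iff PiE_iff
          mod_mult_left_eq mod_mult_right_eq mult.assoc)
  next
    show "\<one>\<^bsub>pair_monoid p\<^esub> \<in> carrier (pair_monoid p)"
      using p by (auto simp: pair_monoid_carrier pair_monoid_one)
  next
    fix a assume a: "a \<in> carrier (pair_monoid p)"
    have *: "f x mod int p = f x" if "f \<in> ?Z \<rightarrow>\<^sub>E ?Z" "x \<in> ?Z" for f x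
      using PiE_mem[OF that] by simp
    show "\<one>\<^bsub>pair_monoid p\<^esub> \<otimes>\<^bsub>pair_monoid p\<^esub> a = a" "a \<otimes>\<^bsub>pair_monoid p\<^esub> \<one>\<^bsub>pair_monoid p\<^esub> = a"
      using a *
      by (cases a; auto simp: pair_monoid_carrier pair_monoid_mult pair_monoid_one compose_def
          fun_eq_iff PiE_iff extensional_def restrict_def)+
  qed
qed

lemma group_pair_group:
  assumes "prime p"
  shows "group (pair_group p)"
  unfolding pair_group_def by (rule monoid.units_group[OF monoid_pair_monoid[OF assms]])

lemma pair_group_mult:
  "(f, f') \<otimes>\<^bsub>pair_group p\<^esub> (g, g') =
     (compose {0..<int p} f g, \<lambda>x\<in>{0..<int p}. f' (g x) * g' x mod int p)"
  by (simp add: pair_group_def units_of_mult pair_monoid_mult)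

lemma pair_group_one:
  "\<one>\<^bsub>pair_group p\<^esub> = (\<lambda>x\<in>{0..<int p}. x, \<lambda>x\<in>{0..<int p}. 1)"
  by (simp add: pair_group_def units_of_one pair_monoid_one)

lemma ex_inverse_mod_prime:
  assumes "prime p" "x \<in> {0<..<int p}"
  shows "\<exists>y\<in>{0<..<int p}. x * y mod int p = 1"
proof -
  have "coprime x (int p)"
    using assms by (metis coprime_commute greaterThanLessThan_iff prime_imp_coprime prime_int_nat_transfer zdvd_not_zless of_nat_0_le_iff nat_int)
  then obtain z where "[x * z = 1] (mod int p)"
    using cong_solve_coprime_int by blast
  then have z: "x * (z mod int p) mod int p = 1"
    using prime_gt_1_nat[OF assms(1)] by (simp add: cong_def mod_mult_right_eq)
  then have "z mod int p \<noteq> 0"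
    by force
  moreover have "0 \<le> z mod int p" "z mod int p < int p"
    using prime_gt_0_nat[OF assms(1)] by simp_all
  ultimately have "z mod int p \<in> {0<..<int p}"
    unfolding greaterThanLessThan_iff by linarith
  then show ?thesis
    using z by blast
qed

text \<open>
  The inverse of \<open>(f, f')\<close> is \<open>(g, 1 / (f' \<circ> g))\<close> with \<open>g\<close> the inverse of \<open>f\<close>.
\<close>

lemma pair_group_carrier:
  assumes "prime p"
  shows "(f, f') \<in> carrier (pair_group p) \<longleftrightarrow>
    f \<in> Bij {0..<int p} \<and> f' \<in> {0..<int p} \<rightarrow>\<^sub>E {0<..<int p}" (is "?L \<longleftrightarrow> ?R")
proof
  let ?Z = "{0..<int p}"
  assume ?L
  then obtain g g' where E: "(f, f') \<in> carrier (pair_monoid p)" "(g, g') \<in> carrier (pair_monoid p)"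
    and inv: "(g, g') \<otimes>\<^bsub>pair_monoid p\<^esub> (f, f') = \<one>\<^bsub>pair_monoid p\<^esub>"
       "(f, f') \<otimes>\<^bsub>pair_monoid p\<^esub> (g, g') = \<one>\<^bsub>pair_monoid p\<^esub>"
    by (auto simp: pair_group_def units_of_carrier Units_def)
  have gf: "g (f x) = x" "f (g x) = x" "g' (f x) * f' x mod int p = 1" if "x \<in> ?Z" for x
    using inv that unfolding pair_monoid_mult pair_monoid_one
    by (auto simp: compose_def restrict_def fun_eq_iff; metis)+
  have maps: "f x \<in> ?Z" "g x \<in> ?Z" "f' x \<in> ?Z" if "x \<in> ?Z" for x
    using E that by (auto simp: pair_monoid_carrier PiE_mem simp del: atLeastLessThan_iff)
  have "bij_betw f ?Z ?Z"
    by (rule bij_betw_byWitness[of _ g]) (use gf maps in blast)+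
  moreover have "f \<in> extensional ?Z" "f' \<in> extensional ?Z"
    using E by (auto simp: pair_monoid_carrier PiE_iff)
  moreover have "f' x \<in> {0<..<int p}" if "x \<in> ?Z" for x
  proof -
    have "f' x \<noteq> 0"
      using gf(3)[OF that] by force
    then show ?thesis
      using maps(3)[OF that] by simp
  qed
  ultimately show ?R
    by (auto simp: Bij_def PiE_iff)
next
  let ?Z = "{0..<int p}"
  assume R: ?R
  define g where "g = (\<lambda>x\<in>?Z. inv_into ?Z f x)"
  define i where "i x = (SOME y. y \<in> {0<..<int p} \<and> x * y mod int p = 1)" for x
  define g' where "g' = (\<lambda>x\<in>?Z. i (f' (g x)))"
  have i: "i x \<in> {0<..<int p}" "x * i x mod int p = 1" if "x \<in> {0<..<int p}" for x
    using someI_ex[OF ex_inverse_mod_prime[OF assms that, unfolded Bex_def]] unfolding i_def by auto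
  have f: "bij_betw f ?Z ?Z" "f \<in> extensional ?Z"
    using R by (auto simp: Bij_def)
  have fmaps: "f x \<in> ?Z" if "x \<in> ?Z" for x
    using f(1) that by (rule bij_betw_apply)
  have gmaps: "g x \<in> ?Z" if "x \<in> ?Z" for x
    using that bij_betw_apply[OF bij_betw_inv_into[OF f(1)]] by (simp add: g_def)
  have gf: "g (f x) = x" "f (g x) = x" if "x \<in> ?Z" for x
    using that f(1) fmaps[OF that]
    by (auto simp: g_def bij_betw_inv_into_left bij_betw_inv_into_right simp del: atLeastLessThan_iff)
  have f': "f' x \<in> {0<..<int p}" if "x \<in> ?Z" for x
    using R that by blast
  have g': "g' x \<in> {0<..<int p}" if "x \<in> ?Z" for x
    using i(1)[OF f'[OF gmaps[OF that]]] that by (simp add: g'_def)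
  have in_Z: "x \<in> ?Z" if "x \<in> {0<..<int p}" for x
    using that by simp
  have "(f, f') \<in> carrier (pair_monoid p)"
    unfolding pair_monoid_carrier using R fmaps f' f(2) in_Z
    by (auto simp: PiE_iff simp del: atLeastLessThan_iff)
  moreover have "(g, g') \<in> carrier (pair_monoid p)"
    unfolding pair_monoid_carrier using gmaps g' in_Z
    by (auto simp: PiE_iff g_def g'_def simp del: atLeastLessThan_iff)
  moreover have "(f, f') \<otimes>\<^bsub>pair_monoid p\<^esub> (g, g') = \<one>\<^bsub>pair_monoid p\<^esub>"
    unfolding pair_monoid_mult pair_monoid_one
    using gf i(2)[OF f'[OF gmaps]] by (auto simp: compose_def g'_def restrict_def fun_eq_iff)
  moreover have "g' (f x) * f' x mod int p = 1" if "x \<in> ?Z" for x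
    using i(2)[OF f'[OF that]] fmaps[OF that] gf(1)[OF that] that
    by (simp add: g'_def mult.commute del: atLeastLessThan_iff)
  then have "(g, g') \<otimes>\<^bsub>pair_monoid p\<^esub> (f, f') = \<one>\<^bsub>pair_monoid p\<^esub>"
    unfolding pair_monoid_mult pair_monoid_one
    using gf by (auto simp: compose_def restrict_def fun_eq_iff)
  ultimately show ?L
    by (auto simp: pair_group_def units_of_carrier Units_def)
qed

section \<open>The projection onto the group of pairs\<close>

text \<open>
  The projection to pairs on representatives: every value of \<open>proj_pair\<close>, at any level \<open>n \<ge> 2\<close>,
  is of this form.
\<close>

definition pair_of_poly :: "nat \<Rightarrow> int poly \<Rightarrow> (int \<Rightarrow> int) \<times> (int \<Rightarrow> int)" where
  "pair_of_poly p f = (poly_map p 1 f, poly_map p 1 (pderiv f))"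

text \<open>
  The composite defining \<open>proj_pair\<close> applies its last factor first, so the induction peels off
  the right end of the composition.
\<close>

lemma proj_pair_poly_map:
  assumes "p > 0" "n \<ge> 2"
  shows "proj_pair p n (poly_map p n f) = pair_of_poly p f"
proof -
  have shift: "foldr (\<circ>) hs k = foldr (\<circ>) hs id \<circ> k" for hs :: "('a \<Rightarrow> 'a) list" and k
    by (induction hs) (simp_all add: comp_assoc)
  have "foldr (\<circ>) (map (proj_step p) [2..<n]) id (poly_map p n f) = poly_map p 2 f"
    using assms(2)
  proof (induction n rule: dec_induct)
    case (step n)
    then have "foldr (\<circ>) (map (proj_step p) [2..<Suc n]) id =
        foldr (\<circ>) (map (proj_step p) [2..<n]) id \<circ> proj_step p n"
      by (simp flip: shift)
    then show ?case
      by (simp only: proj_step_poly_map[OF assms(1)] step.IH comp_apply[of _ "proj_step p n"])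
  qed simp
  then show ?thesis
    using theta_poly_map[OF assms(1)] by (simp add: proj_pair_def pair_of_poly_def)
qed

lemma poly_map_1: "poly_map p (Suc 0) f = (\<lambda>x\<in>{0..<int p}. poly f x mod int p)"
  by (simp add: poly_map_def carrier_residue_ring)

text \<open>
  This is the chain rule, and the reason for the form of the multiplication of pairs.
\<close>

lemma pair_of_poly_pcompose:
  assumes "p > 0"
  shows "pair_of_poly p (pcompose f g) = pair_of_poly p f \<otimes>\<^bsub>pair_group p\<^esub> pair_of_poly p g"
proof -
  have "poly_map p 1 (pderiv (pcompose f g)) =
      (\<lambda>x\<in>{0..<int p}. poly_map p 1 (pderiv f) (poly_map p 1 g x) * poly_map p 1 (pderiv g) x mod int p)"
  proof (rule ext)
    fix x
    show "poly_map p 1 (pderiv (pcompose f g)) x = (\<lambda>x\<in>{0..<int p}.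
      poly_map p 1 (pderiv f) (poly_map p 1 g x) * poly_map p 1 (pderiv g) x mod int p) x"
      using poly_mod_cong[of "poly g x mod int p" "int p" "poly g x" "pderiv f"] assms
      by (simp add: poly_map_1 pderiv_pcompose poly_pcompose mod_mult_eq)
  qed
  then show ?thesis
    using poly_map_compose[OF assms, of 1 f g]
    by (simp add: pair_of_poly_def pair_group_mult carrier_residue_ring)
qed

lemma pair_of_poly_in_carrier_iff:
  assumes p: "prime p"
  shows "pair_of_poly p f \<in> carrier (pair_group p) \<longleftrightarrow>
    (\<forall>x y. int p dvd poly f x - poly f y \<longrightarrow> int p dvd x - y) \<and>
    (\<forall>x. \<not> int p dvd poly (pderiv f) x)"
proof -
  have p0: "p > 0"
    using p prime_gt_0_nat by blast
  have "poly_map p 1 g \<in> {0..<int p} \<rightarrow>\<^sub>E {0<..<int p} \<longleftrightarrow> (\<forall>x. \<not> int p dvd poly g x)" for g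
  proof
    assume L: "poly_map p 1 g \<in> {0..<int p} \<rightarrow>\<^sub>E {0<..<int p}"
    show "\<forall>x. \<not> int p dvd poly g x"
    proof
      fix x
      have "x mod int p \<in> {0..<int p}"
        using p0 by simp
      then have "poly g (x mod int p) mod int p > 0"
        using PiE_mem[OF L, of "x mod int p"] by (simp add: poly_map_1)
      then show "\<not> int p dvd poly g x"
        using poly_mod_cong[of "x mod int p" "int p" x g] by force
    qed
  next
    assume R: "\<forall>x. \<not> int p dvd poly g x"
    have "poly g x mod int p \<in> {0<..<int p}" for x
    proof -
      have "poly g x mod int p \<noteq> 0"
        using R by (simp add: dvd_eq_mod_eq_0)
      moreover have "0 \<le> poly g x mod int p" "poly g x mod int p < int p"
        using p0 by simp_all
      ultimately show ?thesis
        unfolding greaterThanLessThan_iff by linarith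
    qed
    then show "poly_map p 1 g \<in> {0..<int p} \<rightarrow>\<^sub>E {0<..<int p}"
      by (simp add: poly_map_1)
  qed
  then show ?thesis
    using poly_map_in_Bij_iff_inj[OF p0, of 1 f]
    by (simp add: pair_of_poly_def pair_group_carrier[OF p] carrier_residue_ring)
qed

text \<open>
  A permutation modulo \<open>p ^ n\<close> is onto modulo \<open>p\<close>. If the derivative vanished modulo \<open>p\<close> at \<open>x\<close>,
  then \<open>x\<close> and \<open>x + p ^ (n - 1)\<close> would have the same image modulo \<open>p ^ n\<close>, as \<open>2 * (n - 1) \<ge> n\<close>.
  Conversely, if \<open>x\<close> and \<open>y\<close> agree modulo \<open>p\<close>, Taylor expansion writes \<open>f x - f y\<close> as \<open>x - y\<close>
  times a unit modulo \<open>p\<close>.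
\<close>

lemma poly_map_in_poly_perm_group_iff:
  assumes p: "prime p" and n: "n \<ge> 2"
  shows "poly_map p n f \<in> carrier (poly_perm_group p n) \<longleftrightarrow>
    pair_of_poly p f \<in> carrier (pair_group p)" (is "?L \<longleftrightarrow> ?R")
proof -
  have p0: "p > 0"
    using p prime_gt_0_nat by blast
  show ?thesis
  proof
    assume L: ?L
    then have bij: "poly_map p n f \<in> Bij (carrier (Zmod p n))"
      by (simp add: poly_perm_group_carrier)
    have "int p dvd int p ^ n"
      using n by (intro dvd_power) auto
    then have "\<forall>y. \<exists>x. int p ^ 1 dvd poly f x - y"
      using bij[unfolded poly_map_in_Bij_iff_surj[OF p0]] by (metis dvd_trans power_one_right)
    then have "poly_map p 1 f \<in> Bij (carrier (Zmod p 1))"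
      using poly_map_in_Bij_iff_surj[OF p0] by blast
    then have "\<forall>x y. int p dvd poly f x - poly f y \<longrightarrow> int p dvd x - y"
      using poly_map_in_Bij_iff_inj[OF p0, of 1] by simp
    moreover have "\<not> int p dvd poly (pderiv f) x" for x
    proof
      assume dvd: "int p dvd poly (pderiv f) x"
      let ?t = "int p ^ (n - 1)"
      obtain c where c: "poly f (x + ?t) = poly f x + ?t * poly (pderiv f) x + ?t * ?t * c"
        using poly_taylor by blast
      have pn: "int p ^ n = ?t * int p"
        using n by (metis One_nat_def Suc_1 Suc_leD Suc_diff_1 less_eq_Suc_le power_Suc2)
      have "int p dvd ?t"
        using n by (intro dvd_power) auto
      then have "int p ^ n dvd ?t * poly (pderiv f) x + ?t * ?t * c"
        unfolding pn using dvd by (simp add: mult.assoc mult_dvd_mono)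
      then have "int p ^ n dvd poly f (x + ?t) - poly f x"
        unfolding c by (simp add: algebra_simps)
      then have "int p ^ n dvd (x + ?t) - x"
        using bij[unfolded poly_map_in_Bij_iff_inj[OF p0]] by blast
      then have "int (p ^ n) dvd int (p ^ (n - 1))"
        by simp
      then have "p ^ n dvd p ^ (n - 1)"
        by (simp only: int_dvd_int_iff)
      then have "n \<le> n - 1"
        using prime_gt_1_nat[OF p] by (rule power_dvd_imp_le)
      then show False
        using n by simp
    qed
    ultimately show ?R
      by (simp add: pair_of_poly_in_carrier_iff[OF p])
  next
    assume ?R
    then have inj: "\<And>x y. int p dvd poly f x - poly f y \<Longrightarrow> int p dvd x - y"
      and nz: "\<And>x. \<not> int p dvd poly (pderiv f) x"
      by (auto simp: pair_of_poly_in_carrier_iff[OF p])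
    have "int p ^ n dvd x - y" if dvd: "int p ^ n dvd poly f x - poly f y" for x y
    proof -
      have "int p dvd poly f x - poly f y"
        using dvd n by (meson dvd_power dvd_trans less_le_trans pos2)
      then have t: "int p dvd x - y"
        by (rule inj)
      obtain c where c: "poly f (y + (x - y)) =
          poly f y + (x - y) * poly (pderiv f) y + (x - y) * (x - y) * c"
        using poly_taylor by blast
      then have eq: "poly f x - poly f y = (x - y) * (poly (pderiv f) y + (x - y) * c)"
        by (simp add: algebra_simps)
      have "\<not> int p dvd poly (pderiv f) y + (x - y) * c"
        using nz[of y] t by (simp add: dvd_add_left_iff)
      then have "coprime (int p ^ n) (poly (pderiv f) y + (x - y) * c)"
        using p by (simp add: prime_imp_coprime)
      then show ?thesis
        using dvd unfolding eq by (simp add: coprime_dvd_mult_left_iff)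
    qed
    then show ?L
      using poly_map_in_Bij_iff_inj[OF p0] by (auto simp: poly_perm_group_carrier)
  qed
qed

lemma fermat_int:
  assumes "prime p" "\<not> int p dvd a"
  shows "int p dvd a ^ (p - 1) - 1"
proof -
  have p0: "int p > 0"
    using prime_gt_0_nat[OF assms(1)] by simp
  define b where "b = nat (a mod int p)"
  have b: "int b = a mod int p"
    using p0 by (simp add: b_def)
  then have "\<not> p dvd b"
    using assms(2) by (metis dvd_mod_iff dvd_refl int_dvd_int_iff)
  then have "[b ^ (p - 1) = 1] (mod p)"
    by (rule fermat_theorem[OF assms(1)])
  then have "[(a mod int p) ^ (p - 1) = 1] (mod int p)"
    unfolding b[symmetric] by (metis cong_int_iff of_nat_1 of_nat_power)
  then show ?thesis
    by (simp add: cong_def power_mod flip: mod_eq_dvd_iff)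
qed

lemma fermat_int_power:
  assumes "prime p"
  shows "int p dvd a ^ p - a"
proof -
  have "a ^ p - a = a * (a ^ (p - 1) - 1)"
    using prime_gt_0_nat[OF assms] by (simp add: algebra_simps flip: power_Suc)
  then show ?thesis
    using fermat_int[OF assms, of a] by (cases "int p dvd a") auto
qed

text \<open>
  By Fermat's little theorem \<open>1 - (x - a) ^ (p - 1)\<close> is the indicator function of \<open>a\<close>
  modulo \<open>p\<close>.
\<close>

lemma ex_poly_interpolating_mod_prime:
  assumes "prime p"
  shows "\<exists>f :: int poly. \<forall>x\<in>{0..<int p}. int p dvd poly f x - F x"
proof -
  define f where "f = (\<Sum>a\<in>{0..<int p}. smult (F a) (1 - [:- a, 1:] ^ (p - 1)))"
  have "int p dvd poly f x - F x" if x: "x \<in> {0..<int p}" for x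
  proof -
    have "poly f x = (\<Sum>a\<in>{0..<int p}. F a * (1 - (x - a) ^ (p - 1)))"
      by (simp add: f_def poly_sum)
    also have "\<dots> = F x * (1 - 0 ^ (p - 1)) + (\<Sum>a\<in>{0..<int p} - {x}. F a * (1 - (x - a) ^ (p - 1)))"
      using x by (subst sum.remove[of _ x]) auto
    also have "(0::int) ^ (p - 1) = 0"
      using prime_gt_1_nat[OF assms] by simp
    finally have "poly f x - F x = (\<Sum>a\<in>{0..<int p} - {x}. F a * (1 - (x - a) ^ (p - 1)))"
      by simp
    also have "int p dvd \<dots>"
    proof (rule dvd_sum)
      fix a assume a: "a \<in> {0..<int p} - {x}"
      then have "x mod int p \<noteq> a mod int p"
        using x by simp
      then have "\<not> int p dvd x - a"
        by (simp add: mod_eq_dvd_iff)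
      then show "int p dvd F a * (1 - (x - a) ^ (p - 1))"
        using fermat_int[OF assms] by (simp add: dvd_diff_commute)
    qed
    finally show ?thesis .
  qed
  then show ?thesis
    by blast
qed

text \<open>
  The polynomial \<open>x ^ p - x\<close> vanishes on all residues and has derivative \<open>-1\<close> there, so
  \<open>a + (x ^ p - x) * b\<close> keeps the values of \<open>a\<close> and changes the derivative by \<open>- b\<close>. Both \<open>a\<close> and
  \<open>b\<close> come from interpolation.
\<close>

lemma ex_poly_of_pair:
  assumes p: "prime p" and h: "h \<in> carrier (pair_group p)"
  shows "\<exists>f. pair_of_poly p f = h"
proof -
  obtain u v where uv: "h = (u, v)"
    by (cases h)
  then have u: "u \<in> {0..<int p} \<rightarrow>\<^sub>E {0..<int p}" and v: "v \<in> {0..<int p} \<rightarrow>\<^sub>E {0..<int p}"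
    using h pair_group_carrier_imp[of u v p] by (auto simp: carrier_residue_ring)
  obtain a where a: "\<And>x. x \<in> {0..<int p} \<Longrightarrow> int p dvd poly a x - u x"
    using ex_poly_interpolating_mod_prime[OF p] by blast
  obtain b where b: "\<And>x. x \<in> {0..<int p} \<Longrightarrow> int p dvd poly b x - (poly (pderiv a) x - v x)"
    using ex_poly_interpolating_mod_prime[OF p, of "\<lambda>x. poly (pderiv a) x - v x"] by blast
  define f where "f = a + (monom 1 p - [:0, 1:]) * b"
  have "int p dvd poly f x - u x" if "x \<in> {0..<int p}" for x
  proof -
    have eq: "poly f x - u x = (poly a x - u x) + (x ^ p - x) * poly b x"
      by (simp add: f_def poly_monom)
    show ?thesis
      unfolding eq using a[OF that] fermat_int_power[OF p, of x] by (intro dvd_add dvd_mult2)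
  qed
  then have "poly f x mod int p = u x" if "x \<in> {0..<int p}" for x
    using PiE_mem[OF u that] that by (metis atLeastLessThan_iff mod_eq_dvd_iff mod_pos_pos_trivial)
  then have fu: "poly_map p 1 f = u"
    using u by (auto simp: poly_map_1 fun_eq_iff restrict_def PiE_iff extensional_def)
  have "int p dvd poly (pderiv f) x - v x" if "x \<in> {0..<int p}" for x
  proof -
    have "poly (pderiv f) x - v x = - (poly b x - (poly (pderiv a) x - v x))
        + int p * (x ^ (p - 1) * poly b x) + (x ^ p - x) * poly (pderiv b) x"
      by (simp add: f_def poly_monom pderiv_add pderiv_diff pderiv_mult pderiv_monom pderiv_pCons algebra_simps)
    then show ?thesis
      using b[OF that] fermat_int_power[OF p, of x] by (metis dvd_add dvd_minus_iff dvd_mult2 dvd_triv_left)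
  qed
  then have "poly (pderiv f) x mod int p = v x" if "x \<in> {0..<int p}" for x
    using PiE_mem[OF v that] that by (metis atLeastLessThan_iff mod_eq_dvd_iff mod_pos_pos_trivial)
  then have "poly_map p 1 (pderiv f) = v"
    using v by (auto simp: poly_map_1 fun_eq_iff restrict_def PiE_iff extensional_def)
  then show ?thesis
    using fu uv by (auto simp: pair_of_poly_def)
qed

lemma group_hom_proj_pair:
  assumes p: "prime p" and n: "n \<ge> 2"
  shows "group_hom (poly_perm_group p n) (pair_group p) (proj_pair p n)"
proof -
  have p0: "p > 0"
    using p prime_gt_0_nat by blast
  note proj = proj_pair_poly_map[OF p0 n]
  have "proj_pair p n \<in> hom (poly_perm_group p n) (pair_group p)"
  proof (rule homI)
    fix F assume F: "F \<in> carrier (poly_perm_group p n)"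
    then obtain f where f: "F = poly_map p n f"
      by (auto simp: poly_perm_group_carrier)
    then show "proj_pair p n F \<in> carrier (pair_group p)"
      using F poly_map_in_poly_perm_group_iff[OF p n] proj by simp
    fix G assume G: "G \<in> carrier (poly_perm_group p n)"
    then obtain g where g: "G = poly_map p n g"
      by (auto simp: poly_perm_group_carrier)
    show "proj_pair p n (F \<otimes>\<^bsub>poly_perm_group p n\<^esub> G) =
        proj_pair p n F \<otimes>\<^bsub>pair_group p\<^esub> proj_pair p n G"
      using F G unfolding f g
      by (simp add: poly_perm_group_mult[OF p0] proj pair_of_poly_pcompose[OF p0])
  qed
  then show ?thesis
    using group_poly_perm_group[OF p0] group_pair_group[OF p]
    by (simp add: group_hom_def group_hom_axioms_def)
qed

lemma proj_pair_surj:
  assumes p: "prime p" and n: "n \<ge> 2"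
  shows "proj_pair p n ` carrier (poly_perm_group p n) = carrier (pair_group p)"
proof
  interpret group_hom "poly_perm_group p n" "pair_group p" "proj_pair p n"
    by (rule group_hom_proj_pair[OF assms])
  show "proj_pair p n ` carrier (poly_perm_group p n) \<subseteq> carrier (pair_group p)"
    by auto
  show "carrier (pair_group p) \<subseteq> proj_pair p n ` carrier (poly_perm_group p n)"
  proof
    fix h assume h: "h \<in> carrier (pair_group p)"
    then obtain f where f: "pair_of_poly p f = h"
      using ex_poly_of_pair[OF p] by blast
    then have "poly_map p n f \<in> carrier (poly_perm_group p n)"
      using h poly_map_in_poly_perm_group_iff[OF p n] by simp
    moreover have "proj_pair p n (poly_map p n f) = h"
      using proj_pair_poly_map[OF prime_gt_0_nat[OF p] n] f by simp
    ultimately show "h \<in> proj_pair p n ` carrier (poly_perm_group p n)"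
      by blast
  qed
qed

text \<open>
  Write \<open>t = h x - x\<close>, a multiple of \<open>p ^ m\<close>. Modulo \<open>p ^ (m + 1)\<close> each application of \<open>h\<close> adds
  another \<open>t\<close>, because the derivative is \<open>1\<close> modulo \<open>p\<close> and \<open>t\<^sup>2\<close> vanishes. After \<open>p\<close> applications
  the displacement \<open>p * t\<close> vanishes too.
\<close>

lemma poly_perm_pow_p_congruence:
  assumes p: "prime p" and m: "m \<ge> 1"
    and F: "poly_map p n h \<in> carrier (poly_perm_group p n)"
    and h: "\<And>x. int p ^ m dvd poly h x - x"
    and h': "\<And>x. int p dvd poly (pderiv h) x - 1"
  shows "\<exists>g. poly_map p n h [^]\<^bsub>poly_perm_group p n\<^esub> p = poly_map p n g \<and>
    (\<forall>x. int p ^ Suc m dvd poly g x - x) \<and> (\<forall>x. int p dvd poly (pderiv g) x - 1)"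
proof -
  have p0: "p > 0"
    using p prime_gt_0_nat by blast
  interpret group "poly_perm_group p n"
    by (rule group_poly_perm_group[OF p0])
  have "\<exists>g. poly_map p n h [^]\<^bsub>poly_perm_group p n\<^esub> j = poly_map p n g \<and>
    (\<forall>x. int p ^ Suc m dvd poly g x - x - int j * (poly h x - x)) \<and>
    (\<forall>x. int p dvd poly (pderiv g) x - 1)" for j
  proof (induction j)
    case 0
    show ?case
      by (rule exI[of _ "[:0, 1:]"]) (simp add: poly_perm_group_one pderiv_pCons)
  next
    case (Suc j)
    then obtain g where g: "poly_map p n h [^]\<^bsub>poly_perm_group p n\<^esub> j = poly_map p n g"
      and gx: "\<And>x. int p ^ Suc m dvd poly g x - x - int j * (poly h x - x)"
      and g': "\<And>x. int p dvd poly (pderiv g) x - 1"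
      by blast
    have "poly_map p n g \<in> carrier (poly_perm_group p n)"
      using nat_pow_closed[OF F, of j] unfolding g .
    then have "poly_map p n h [^]\<^bsub>poly_perm_group p n\<^esub> Suc j = poly_map p n (pcompose g h)"
      using F by (simp add: g poly_perm_group_mult[OF p0])
    moreover have "int p ^ Suc m dvd poly (pcompose g h) x - x - int (Suc j) * (poly h x - x)" for x
    proof -
      let ?t = "poly h x - x"
      obtain c where "poly g (x + ?t) = poly g x + ?t * poly (pderiv g) x + ?t * ?t * c"
        using poly_taylor by blast
      then have eq: "poly (pcompose g h) x - x - int (Suc j) * ?t =
          (poly g x - x - int j * ?t) + ?t * (poly (pderiv g) x - 1) + ?t * ?t * c"
        by (simp add: poly_pcompose algebra_simps)
      have "int p ^ Suc m dvd ?t * (poly (pderiv g) x - 1)"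
        using mult_dvd_mono[OF h g'] by (simp add: mult.commute)
      moreover have "int p dvd ?t"
        using h[of x] m by (metis dvd_power dvd_trans less_eq_Suc_le One_nat_def)
      then have "int p ^ Suc m dvd ?t * ?t * c"
        using mult_dvd_mono[OF _ h[of x], of "int p" ?t] by (simp add: dvd_mult2)
      ultimately show ?thesis
        unfolding eq using gx[of x] by (intro dvd_add)
    qed
    moreover have "int p dvd poly (pderiv (pcompose g h)) x - 1" for x
    proof -
      have eq: "poly (pderiv (pcompose g h)) x - 1 =
          (poly (pderiv g) (poly h x) - 1) * poly (pderiv h) x + (poly (pderiv h) x - 1)"
        by (simp add: pderiv_pcompose poly_pcompose algebra_simps)
      show ?thesis
        unfolding eq using g' h' by (intro dvd_add dvd_mult2)
    qed
    ultimately show ?case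
      by blast
  qed
  from this[of p] obtain g where g: "poly_map p n h [^]\<^bsub>poly_perm_group p n\<^esub> p = poly_map p n g"
    "\<And>x. int p ^ Suc m dvd poly g x - x - int p * (poly h x - x)"
    "\<And>x. int p dvd poly (pderiv g) x - 1"
    by blast
  have "int p ^ Suc m dvd int p * (poly h x - x)" for x
    using h[of x] by simp
  then have "int p ^ Suc m dvd (poly g x - x - int p * (poly h x - x)) + int p * (poly h x - x)" for x
    using g(2)[of x] by (intro dvd_add)
  then have "int p ^ Suc m dvd poly g x - x" for x
    by (metis diff_add_cancel)
  then show ?thesis
    using g by blast
qed

text \<open>
  The preceding congruence gains one factor of \<open>p\<close> per \<open>p\<close>-th power, so it can be iterated until
  the displacement vanishes modulo \<open>p ^ n\<close>.
\<close>

lemma kernel_proj_pair_p_power_order: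
  assumes p: "prime p" and n: "n \<ge> 2"
    and F: "F \<in> carrier (poly_perm_group p n)" and ker: "proj_pair p n F = \<one>\<^bsub>pair_group p\<^esub>"
  shows "p_power_order p (poly_perm_group p n) F"
proof -
  have p0: "p > 0"
    using p prime_gt_0_nat by blast
  interpret group "poly_perm_group p n"
    by (rule group_poly_perm_group[OF p0])
  obtain h where h: "F = poly_map p n h"
    using F by (auto simp: poly_perm_group_carrier)
  have "pair_of_poly p [:0, 1:] = \<one>\<^bsub>pair_group p\<^esub>"
    using prime_gt_1_nat[OF p]
    by (auto simp: pair_of_poly_def pair_group_one poly_map_1 pderiv_pCons restrict_def fun_eq_iff)
  then have "pair_of_poly p h = pair_of_poly p [:0, 1:]"
    using ker proj_pair_poly_map[OF p0 n] unfolding h by simp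
  then have hx: "int p ^ 1 dvd poly h x - x" "int p dvd poly (pderiv h) x - 1" for x
    by (auto simp: pair_of_poly_def poly_map_eq_iff[OF p0] mod_eq_dvd_iff pderiv_pCons)
  have "\<exists>g. F [^]\<^bsub>poly_perm_group p n\<^esub> (p ^ k) = poly_map p n g \<and>
    (\<forall>x. int p ^ Suc k dvd poly g x - x) \<and> (\<forall>x. int p dvd poly (pderiv g) x - 1)" for k
  proof (induction k)
    case 0
    then show ?case
      using F hx by (auto simp: h)
  next
    case (Suc k)
    then obtain g where g: "F [^]\<^bsub>poly_perm_group p n\<^esub> (p ^ k) = poly_map p n g"
      "\<And>x. int p ^ Suc k dvd poly g x - x" "\<And>x. int p dvd poly (pderiv g) x - 1"
      by blast
    have "F [^]\<^bsub>poly_perm_group p n\<^esub> (p ^ Suc k) = poly_map p n g [^]\<^bsub>poly_perm_group p n\<^esub> p"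
      using F by (simp add: nat_pow_pow mult.commute flip: g(1))
    moreover have "poly_map p n g \<in> carrier (poly_perm_group p n)"
      using nat_pow_closed[OF F, of "p ^ k"] unfolding g(1) .
    ultimately show ?case
      using poly_perm_pow_p_congruence[OF p _ _ g(2,3), of n] by simp
  qed
  from this[of n] obtain g where g: "F [^]\<^bsub>poly_perm_group p n\<^esub> (p ^ n) = poly_map p n g"
    "\<And>x. int p ^ Suc n dvd poly g x - x"
    by blast
  have "int p ^ n dvd poly g x - x" for x
    using g(2)[of x] by (simp add: dvd_mult_right)
  then have "poly_map p n g = poly_map p n [:0, 1:]"
    by (simp add: poly_map_eq_iff[OF p0] mod_eq_dvd_iff)
  then show ?thesis
    using g(1) p_power_order_iff[OF p F] by (auto simp: poly_perm_group_one)
qed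

section \<open>The projective limit\<close>

lemma limit_group_carrier:
  "(a, h, g) \<in> carrier (limit_group p) \<longleftrightarrow>
     a \<in> carrier (poly_perm_group p 1) \<and> h \<in> carrier (pair_group p) \<and>
     g \<in> (\<Pi>\<^sub>E n\<in>{2..}. carrier (poly_perm_group p n)) \<and>
     psi h = a \<and> theta p (g 2) = h \<and> (\<forall>n\<ge>2. proj_step p n (g (Suc n)) = g n)"
  by (auto simp: limit_group_def Let_def DirProd_def)

lemma group_hom_psi:
  assumes p: "prime p"
  shows "group_hom (pair_group p) (poly_perm_group p 1) psi"
proof -
  have "psi \<in> hom (pair_group p) (poly_perm_group p 1)"
  proof (rule homI)
    fix h assume h: "h \<in> carrier (pair_group p)"
    then obtain f where f: "pair_of_poly p f = h"
      using ex_poly_of_pair[OF p] by blast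
    then show "psi h \<in> carrier (poly_perm_group p 1)"
      using h pair_group_carrier[OF p]
      by (auto simp: psi_def pair_of_poly_def poly_perm_group_carrier carrier_residue_ring)
    fix k assume k: "k \<in> carrier (pair_group p)"
    show "psi (h \<otimes>\<^bsub>pair_group p\<^esub> k) = psi h \<otimes>\<^bsub>poly_perm_group p 1\<^esub> psi k"
      using h k pair_group_carrier[OF p]
      by (cases h; cases k)
        (simp add: psi_def pair_group_mult poly_perm_group_def BijGroup_def carrier_residue_ring)
  qed
  then show ?thesis
    using group_poly_perm_group[OF prime_gt_0_nat[OF p]] group_pair_group[OF p]
    by (simp add: group_hom_def group_hom_axioms_def)
qed

lemma group_hom_proj_step:
  assumes p: "prime p" and n: "n \<ge> 2"
  shows "group_hom (poly_perm_group p (Suc n)) (poly_perm_group p n) (proj_step p n)"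
proof -
  have p0: "p > 0"
    using p prime_gt_0_nat by blast
  note step = proj_step_poly_map[OF p0]
  have Suc_n: "Suc n \<ge> 2"
    using n by simp
  have closed: "poly_map p n f \<in> carrier (poly_perm_group p n)"
    if "poly_map p (Suc n) f \<in> carrier (poly_perm_group p (Suc n))" for f
    using that poly_map_in_poly_perm_group_iff[OF p n] poly_map_in_poly_perm_group_iff[OF p Suc_n]
    by simp
  have "proj_step p n \<in> hom (poly_perm_group p (Suc n)) (poly_perm_group p n)"
  proof (rule homI)
    fix F assume F: "F \<in> carrier (poly_perm_group p (Suc n))"
    then obtain f where f: "F = poly_map p (Suc n) f"
      by (auto simp: poly_perm_group_carrier)
    then show "proj_step p n F \<in> carrier (poly_perm_group p n)"
      using F closed step by simp
    fix G assume G: "G \<in> carrier (poly_perm_group p (Suc n))"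
    then obtain g where g: "G = poly_map p (Suc n) g"
      by (auto simp: poly_perm_group_carrier)
    show "proj_step p n (F \<otimes>\<^bsub>poly_perm_group p (Suc n)\<^esub> G) =
        proj_step p n F \<otimes>\<^bsub>poly_perm_group p n\<^esub> proj_step p n G"
      using F G closed unfolding f g
      by (simp add: poly_perm_group_mult[OF p0] step)
  qed
  then show ?thesis
    using group_poly_perm_group[OF p0] by (simp add: group_hom_def group_hom_axioms_def)
qed

lemma proj_pair_2: "proj_pair p 2 = theta p"
  by (simp add: proj_pair_def)

text \<open>
  The limit is cut out of the product by equations between homomorphisms.
\<close>

lemma group_limit_group:
  assumes p: "prime p"
  shows "group (limit_group p)"
proof -
  have p0: "p > 0"
    using p prime_gt_0_nat by blast
  let ?G = "poly_perm_group p" and ?H = "pair_group p"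
  let ?R = "product_group {2..} ?G"
  let ?P = "?G 1 \<times>\<times> ?H \<times>\<times> ?R"
  let ?K = "carrier (limit_group p)"
  note grpG = group_poly_perm_group[OF p0] and grpH = group_pair_group[OF p]
  have grpR: "group ?R"
    using grpG by simp
  have grpP: "group ?P"
    by (intro DirProd_group grpG grpH grpR)
  interpret psi: group_hom ?H "?G 1" psi
    by (rule group_hom_psi[OF p])
  interpret theta: group_hom "?G 2" ?H "theta p"
    using group_hom_proj_pair[OF p, of 2] by (simp add: proj_pair_2)
  have step: "group_hom (?G (Suc n)) (?G n) (proj_step p n)" if "n \<ge> 2" for n
    using group_hom_proj_step[OF p that] .
  have comp: "g n \<in> carrier (?G n)" if "g \<in> carrier ?R" "n \<ge> 2" for g n
    using that by auto
  have "subgroup ?K ?P"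
  proof (rule group.subgroupI[OF grpP])
    show "?K \<subseteq> carrier ?P"
      by (auto simp: limit_group_def Let_def)
    have "\<one>\<^bsub>?P\<^esub> \<in> ?K"
      using step grpG
      by (auto simp: limit_group_carrier DirProd_def group_hom.hom_one group.is_monoid monoid.one_closed)
    then show "?K \<noteq> {}"
      by blast
  next
    fix z assume z: "z \<in> ?K"
    obtain a h g where zeq: "z = (a, h, g)"
      by (cases z)
    have mem: "a \<in> carrier (?G 1)" "h \<in> carrier ?H" "g \<in> carrier ?R"
      and compat: "psi h = a" "theta p (g 2) = h" "\<And>n. n \<ge> 2 \<Longrightarrow> proj_step p n (g (Suc n)) = g n"
      using z by (auto simp: zeq limit_group_carrier)
    have inv_g: "inv\<^bsub>?R\<^esub> g = (\<lambda>n\<in>{2..}. inv\<^bsub>?G n\<^esub> g n)"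
      using mem(3) grpG by (intro inv_product_group) auto
    have inv_z: "inv\<^bsub>?P\<^esub> z = (inv\<^bsub>?G 1\<^esub> a, inv\<^bsub>?H\<^esub> h, \<lambda>n\<in>{2..}. inv\<^bsub>?G n\<^esub> g n)"
      unfolding zeq using mem grpG grpH grpR
      by (simp add: inv_DirProd DirProd_group inv_g del: carrier_product_group)
    show "inv\<^bsub>?P\<^esub> z \<in> ?K"
      unfolding inv_z limit_group_carrier
      using mem compat comp[OF mem(3)] grpG
      by (auto simp: group_hom.hom_inv[OF step] group.inv_closed simp del: carrier_product_group)
    fix z' assume z': "z' \<in> ?K"
    obtain a' h' g' where zeq': "z' = (a', h', g')"
      by (cases z')
    have mem': "a' \<in> carrier (?G 1)" "h' \<in> carrier ?H" "g' \<in> carrier ?R"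
      and compat': "psi h' = a'" "theta p (g' 2) = h'" "\<And>n. n \<ge> 2 \<Longrightarrow> proj_step p n (g' (Suc n)) = g' n"
      using z' by (auto simp: zeq' limit_group_carrier)
    show "z \<otimes>\<^bsub>?P\<^esub> z' \<in> ?K"
      unfolding zeq zeq' mult_DirProd limit_group_carrier mult_product_group
      using mem compat comp[OF mem(3)] mem' compat' comp[OF mem'(3)] grpG
      by (auto simp: group_hom.hom_mult[OF step] group.is_monoid monoid.m_closed
          simp del: carrier_product_group)
  qed
  moreover have "limit_group p = ?P\<lparr>carrier := ?K\<rparr>"
    by (simp add: limit_group_def Let_def)
  ultimately show ?thesis
    using subgroup.subgroup_is_group[OF _ grpP] by metis
qed

lemma group_hom_limit_proj_pair:
  assumes p: "prime p"
  shows "group_hom (limit_group p) (pair_group p) limit_proj_pair"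
proof -
  have "limit_proj_pair \<in> hom (limit_group p) (pair_group p)"
  proof (rule homI)
    fix z z' assume "z \<in> carrier (limit_group p)" "z' \<in> carrier (limit_group p)"
    then show "limit_proj_pair (z \<otimes>\<^bsub>limit_group p\<^esub> z') =
        limit_proj_pair z \<otimes>\<^bsub>pair_group p\<^esub> limit_proj_pair z'"
      by (cases z; cases z') (simp add: limit_proj_pair_def limit_group_def Let_def DirProd_def)
  qed (auto simp: limit_proj_pair_def limit_group_carrier)
  then show ?thesis
    using group_limit_group[OF p] group_pair_group[OF p]
    by (simp add: group_hom_def group_hom_axioms_def)
qed

text \<open>
  A single polynomial lifts a pair to all levels at once, compatibly.
\<close>

lemma limit_proj_pair_surj:
  assumes p: "prime p"
  shows "limit_proj_pair ` carrier (limit_group p) = carrier (pair_group p)"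
proof
  show "limit_proj_pair ` carrier (limit_group p) \<subseteq> carrier (pair_group p)"
    by (auto simp: limit_proj_pair_def limit_group_carrier)
  show "carrier (pair_group p) \<subseteq> limit_proj_pair ` carrier (limit_group p)"
  proof
    fix h assume h: "h \<in> carrier (pair_group p)"
    have p0: "p > 0"
      using p prime_gt_0_nat by blast
    obtain f where f: "pair_of_poly p f = h"
      using ex_poly_of_pair[OF p h] by blast
    have "psi h = poly_map p 1 f"
      using f by (auto simp: psi_def pair_of_poly_def)
    moreover have "psi h \<in> carrier (poly_perm_group p 1)"
      using h group_hom.hom_closed[OF group_hom_psi[OF p]] by blast
    moreover have "theta p (poly_map p 2 f) = h"
      using f by (simp add: theta_poly_map[OF p0] pair_of_poly_def)
    moreover have "poly_map p n f \<in> carrier (poly_perm_group p n)" if "n \<ge> 2" for n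
      using poly_map_in_poly_perm_group_iff[OF p that] f h by simp
    ultimately have "(psi h, h, \<lambda>n\<in>{2..}. poly_map p n f) \<in> carrier (limit_group p)"
      using h by (auto simp: limit_group_carrier proj_step_poly_map[OF p0])
    then show "h \<in> limit_proj_pair ` carrier (limit_group p)"
      by (metis fst_conv image_eqI limit_proj_pair_def snd_conv)
  qed
qed

lemma proj_pair_limit_component:
  assumes p: "prime p" and z: "(a, h, g) \<in> carrier (limit_group p)" and n: "n \<ge> 2"
  shows "proj_pair p n (g n) = h"
  using n
proof (induction n rule: dec_induct)
  case base
  then show ?case
    using z by (simp add: proj_pair_2 limit_group_carrier)
next
  case (step n)
  have p0: "p > 0"
    using p prime_gt_0_nat by blast
  have "g (Suc n) \<in> carrier (poly_perm_group p (Suc n))"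
    using z step.hyps by (auto simp: limit_group_carrier PiE_iff)
  then obtain f where f: "g (Suc n) = poly_map p (Suc n) f"
    by (auto simp: poly_perm_group_carrier)
  have "g n = poly_map p n f"
    using z step.hyps f by (metis limit_group_carrier proj_step_poly_map[OF p0])
  then show ?case
    using step f by (simp add: proj_pair_poly_map[OF p0])
qed

section \<open>Sylow subgroups as preimages\<close>

lemma p_power_order_proj_pair_iff:
  assumes p: "prime p" and n: "n \<ge> 2" and F: "F \<in> carrier (poly_perm_group p n)"
  shows "p_power_order p (poly_perm_group p n) F \<longleftrightarrow>
    p_power_order p (pair_group p) (proj_pair p n F)"
  by (rule group_hom.p_power_order_hom_iff[OF group_hom_proj_pair[OF p n] p _ F])
    (rule kernel_proj_pair_p_power_order[OF p n])

lemma sylow_subgroups_poly_perm_group: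
  assumes p: "prime p" and n: "n \<ge> 2"
  shows "{P. sylow_subgroup p (poly_perm_group p n) P} =
      (\<lambda>S. {F \<in> carrier (poly_perm_group p n). proj_pair p n F \<in> S})
        ` {S. sylow_subgroup p (pair_group p) S}"
    and "inj_on (\<lambda>S. {F \<in> carrier (poly_perm_group p n). proj_pair p n F \<in> S})
        {S. sylow_subgroup p (pair_group p) S}"
  unfolding sylow_subgroup_eq_maximal_subgroup_with
  by (rule group_hom.maximal_subgroups_with_preimage[OF group_hom_proj_pair[OF p n]
        proj_pair_surj[OF p n]], erule p_power_order_proj_pair_iff[OF p n])+

text \<open>
  The condition that membership in a \<open>p\<close>-subgroup of the limit imposes on each element.
\<close>

definition limit_p_power_order ::
  "nat \<Rightarrow> ((int \<Rightarrow> int) \<times> ((int \<Rightarrow> int) \<times> (int \<Rightarrow> int)) \<times> (nat \<Rightarrow> int \<Rightarrow> int)) \<Rightarrow> bool" where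
  "limit_p_power_order p = (\<lambda>(a, h, g).
     p_power_order p (poly_perm_group p 1) a \<and> p_power_order p (pair_group p) h \<and>
     (\<forall>n\<ge>2. p_power_order p (poly_perm_group p n) (g n)))"

text \<open>
  The component modulo \<open>p\<close> is the image of the pair under \<open>psi\<close>, and every component modulo
  \<open>p ^ n\<close> projects onto the pair with kernel of \<open>p\<close>-power order.
\<close>

lemma limit_p_power_order_iff:
  assumes p: "prime p" and z: "z \<in> carrier (limit_group p)"
  shows "limit_p_power_order p z \<longleftrightarrow> p_power_order p (pair_group p) (limit_proj_pair z)"
proof -
  obtain a h g where zeq: "z = (a, h, g)"
    by (cases z)
  have mem: "a \<in> carrier (poly_perm_group p 1)" "h \<in> carrier (pair_group p)" "psi h = a"
    "\<And>n. n \<ge> 2 \<Longrightarrow> g n \<in> carrier (poly_perm_group p n)"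
    using z by (auto simp: zeq limit_group_carrier PiE_iff)
  interpret psi: group_hom "pair_group p" "poly_perm_group p 1" psi
    by (rule group_hom_psi[OF p])
  have "p_power_order p (poly_perm_group p 1) a" if h: "p_power_order p (pair_group p) h"
  proof -
    obtain k where "h [^]\<^bsub>pair_group p\<^esub> (p ^ k) = \<one>\<^bsub>pair_group p\<^esub>"
      using h psi.G.p_power_order_iff[OF p mem(2)] by blast
    then have "a [^]\<^bsub>poly_perm_group p 1\<^esub> (p ^ k) = \<one>\<^bsub>poly_perm_group p 1\<^esub>"
      using mem(2,3) psi.hom_nat_pow[of h "p ^ k"] by simp
    then show ?thesis
      using psi.H.p_power_order_iff[OF p mem(1)] by blast
  qed
  moreover have "p_power_order p (poly_perm_group p n) (g n) \<longleftrightarrow> p_power_order p (pair_group p) h"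
    if "n \<ge> 2" for n
    using p_power_order_proj_pair_iff[OF p that mem(4)[OF that]]
      proj_pair_limit_component[OF p z[unfolded zeq] that] by simp
  ultimately show ?thesis
    by (auto simp: limit_p_power_order_def limit_proj_pair_def zeq)
qed

lemma limit_sylow_subgroups:
  assumes p: "prime p"
  shows "{P. limit_sylow_subgroup p P} =
      (\<lambda>S. {z \<in> carrier (limit_group p). limit_proj_pair z \<in> S})
        ` {S. sylow_subgroup p (pair_group p) S}"
    and "inj_on (\<lambda>S. {z \<in> carrier (limit_group p). limit_proj_pair z \<in> S})
        {S. sylow_subgroup p (pair_group p) S}"
proof -
  have eq: "limit_sylow_subgroup p P \<longleftrightarrow>
      maximal_subgroup_with (limit_p_power_order p) (limit_group p) P" for P
    unfolding limit_sylow_subgroup_def limit_p_subgroup_def maximal_subgroup_with_def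
      limit_p_power_order_def ..
  note * = group_hom.maximal_subgroups_with_preimage[OF group_hom_limit_proj_pair[OF p]
        limit_proj_pair_surj[OF p]]
  show "{P. limit_sylow_subgroup p P} =
      (\<lambda>S. {z \<in> carrier (limit_group p). limit_proj_pair z \<in> S})
        ` {S. sylow_subgroup p (pair_group p) S}"
    unfolding eq sylow_subgroup_eq_maximal_subgroup_with by (rule *(1)) (rule limit_p_power_order_iff[OF p])
  show "inj_on (\<lambda>S. {z \<in> carrier (limit_group p). limit_proj_pair z \<in> S})
        {S. sylow_subgroup p (pair_group p) S}"
    unfolding sylow_subgroup_eq_maximal_subgroup_with by (rule *(2)) (rule limit_p_power_order_iff[OF p])
qed

section \<open>Free action of the p-subgroups\<close>

lemma pair_group_mult_apply:
  assumes "x \<in> {0..<int p}"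
  shows "fst (q \<otimes>\<^bsub>pair_group p\<^esub> r) x = fst q (fst r x)"
    and "snd (q \<otimes>\<^bsub>pair_group p\<^esub> r) x = snd q (fst r x) * snd r x mod int p"
  using assms by (cases q; cases r; simp add: pair_group_mult compose_def)+

lemma pair_group_one_apply:
  assumes "x \<in> {0..<int p}"
  shows "fst (\<one>\<^bsub>pair_group p\<^esub>) x = x" and "snd (\<one>\<^bsub>pair_group p\<^esub>) x = 1"
  using assms by (simp_all add: pair_group_one)

lemma pair_group_maps:
  assumes "prime p" "q \<in> carrier (pair_group p)" "x \<in> {0..<int p}"
  shows "fst q x \<in> {0..<int p}" and "snd q x \<in> {0<..<int p}"
  using assms pair_group_carrier[OF assms(1), of "fst q" "snd q"]
  by (auto simp: Bij_def PiE_iff bij_betw_apply simp del: atLeastLessThan_iff greaterThanLessThan_iff)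

lemma pair_group_eqI:
  assumes p: "prime p" and q: "q \<in> carrier (pair_group p)" "r \<in> carrier (pair_group p)"
    and eq: "\<And>x. x \<in> {0..<int p} \<Longrightarrow> fst q x = fst r x"
      "\<And>x. x \<in> {0..<int p} \<Longrightarrow> snd q x = snd r x"
  shows "q = r"
proof (rule prod_eqI)
  have "fst q \<in> extensional {0..<int p}" "fst r \<in> extensional {0..<int p}"
    "snd q \<in> extensional {0..<int p}" "snd r \<in> extensional {0..<int p}"
    using q pair_group_carrier[OF p, of "fst q" "snd q"] pair_group_carrier[OF p, of "fst r" "snd r"]
    by (auto simp: Bij_def PiE_iff)
  then show "fst q = fst r" "snd q = snd r"
    using eq by (blast intro: extensionalityI)+
qed

lemma BijGroup_pow_apply:
  assumes f: "f \<in> Bij S" and x: "x \<in> S"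
  shows "(f [^]\<^bsub>BijGroup S\<^esub> (k::nat)) x = (f ^^ k) x"
  using x
proof (induction k arbitrary: x)
  case 0
  then show ?case
    by (simp add: BijGroup_def)
next
  case (Suc k)
  interpret group "BijGroup S"
    by (rule group_BijGroup)
  have "f [^]\<^bsub>BijGroup S\<^esub> k \<in> Bij S"
    using nat_pow_closed[of f k] f by (simp only: carrier_BijGroup)
  then have "f [^]\<^bsub>BijGroup S\<^esub> Suc k = compose S (f [^]\<^bsub>BijGroup S\<^esub> k) f"
    using f by (simp add: BijGroup_mult)
  moreover have "f x \<in> S"
    using f Suc.prems by (auto simp: Bij_def bij_betw_apply)
  ultimately show ?case
    using Suc by (simp add: compose_def funpow_swap1)
qed

lemma group_hom_fst_pair_group:
  assumes p: "prime p"
  shows "group_hom (pair_group p) (BijGroup {0..<int p}) fst"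
proof -
  have "fst \<in> hom (pair_group p) (BijGroup {0..<int p})"
    using pair_group_carrier[OF p]
    by (intro homI) (auto simp: carrier_BijGroup BijGroup_mult pair_group_mult)
  then show ?thesis
    using group_pair_group[OF p] group_BijGroup by (simp add: group_hom_def group_hom_axioms_def)
qed

lemma fst_pair_group_pow:
  assumes p: "prime p" and q: "q \<in> carrier (pair_group p)" and x: "x \<in> {0..<int p}"
  shows "fst (q [^]\<^bsub>pair_group p\<^esub> (k::nat)) x = (fst q ^^ k) x"
proof -
  interpret group_hom "pair_group p" "BijGroup {0..<int p}" fst
    by (rule group_hom_fst_pair_group[OF p])
  have "fst q \<in> Bij {0..<int p}"
    using hom_closed[OF q] by (simp only: carrier_BijGroup)
  then show ?thesis
    using BijGroup_pow_apply[OF _ x, of "fst q" k] by (simp only: hom_nat_pow[OF q])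
qed

lemma snd_pair_group_pow_fixed_point:
  assumes p: "prime p" and q: "q \<in> carrier (pair_group p)" and x: "x \<in> {0..<int p}" "fst q x = x"
  shows "snd (q [^]\<^bsub>pair_group p\<^esub> (k::nat)) x = snd q x ^ k mod int p"
proof (induction k)
  case 0
  then show ?case
    using x prime_gt_1_nat[OF p] by (simp add: pair_group_one_apply)
next
  case (Suc k)
  interpret group "pair_group p"
    by (rule group_pair_group[OF p])
  show ?case
    using Suc x by (simp add: pair_group_mult_apply mod_mult_right_eq mult.commute del: atLeastLessThan_iff)
qed

text \<open>
  The periods of a point are closed under greatest common divisors, by Bezout's identity.
\<close>

lemma funpow_gcd_fixed_point:
  fixes a b :: nat
  assumes "(f ^^ a) x = x" "(f ^^ b) x = x"
  shows "(f ^^ gcd a b) x = x"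
proof (cases "a = 0")
  case False
  have mult: "(f ^^ (c * k)) x = x" if "(f ^^ c) x = x" for c k
    using that by (induction k) (simp_all add: funpow_add)
  obtain u v where uv: "a * u = b * v + gcd a b"
    using bezout_nat[OF False] by blast
  have "x = (f ^^ (gcd a b + b * v)) x"
    using mult[OF assms(1), of u] uv by (simp add: add.commute)
  also have "\<dots> = (f ^^ gcd a b) x"
    using mult[OF assms(2), of v] by (simp add: funpow_add)
  finally show ?thesis
    by simp
qed (use assms in simp)

text \<open>
  A second point \<open>y\<close> moves within \<open>p - 1\<close> points, so by the pigeonhole principle it has a period
  \<open>j - i\<close> less than \<open>p\<close>. This is coprime to the period \<open>p ^ k\<close>, so \<open>y\<close> has period \<open>1\<close>.
\<close>

lemma p_power_permutation_fixed_point: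
  assumes p: "prime p" and S: "finite S" "card S = p"
    and f: "f ` S \<subseteq> S" "inj_on f S" and pow: "\<And>x. x \<in> S \<Longrightarrow> (f ^^ (p ^ k)) x = x"
    and x: "x \<in> S" "f x = x" and y: "y \<in> S"
  shows "f y = y"
proof (cases "y = x")
  case False
  have iter: "(f ^^ i) y \<in> S - {x}" for i
  proof (induction i)
    case (Suc i)
    then show ?case
      using f x by (auto simp: inj_on_def)
  qed (use False y in simp)
  have "\<not> inj_on (\<lambda>i. (f ^^ i) y) {..<p}"
  proof
    assume "inj_on (\<lambda>i. (f ^^ i) y) {..<p}"
    then have "card {..<p} \<le> card (S - {x})"
      by (rule card_inj_on_le) (use iter S(1) in auto)
    then show False
      using S x prime_gt_0_nat[OF p] by simp
  qed
  then obtain i j where ij: "i < j" "j < p" "(f ^^ i) y = (f ^^ j) y"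
    by (auto simp: inj_on_def) (metis linorder_neqE_nat)
  have "inj_on (f ^^ i) S"
  proof (induction i)
    case (Suc i)
    have "(f ^^ i) ` S \<subseteq> S"
      using f(1) by (induction i) auto
    then show ?case
      using comp_inj_on[OF Suc inj_on_subset[OF f(2)]] by (simp add: comp_def)
  qed simp
  moreover have "(f ^^ i) ((f ^^ (j - i)) y) = (f ^^ i) y"
    using ij by (metis comp_apply funpow_add le_add_diff_inverse less_imp_le)
  ultimately have "(f ^^ (j - i)) y = y"
    using iter y by (auto dest: inj_onD)
  then have "(f ^^ gcd (p ^ k) (j - i)) y = y"
    using pow[OF y] by (intro funpow_gcd_fixed_point)
  moreover have "coprime (p ^ k) (j - i)"
    using p ij by (auto intro!: prime_imp_coprime dest: dvd_imp_le)
  ultimately show ?thesis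
    by simp
qed (use x in simp)

text \<open>
  Once \<open>f\<close> is known to be the identity, powers of \<open>(f, f')\<close> are taken pointwise in \<open>f'\<close>, and the
  \<open>p ^ k\<close>-th power map is the identity on the residues modulo \<open>p\<close>.
\<close>

lemma pair_p_power_order_fixed_point:
  assumes p: "prime p" and q: "q \<in> carrier (pair_group p)" "p_power_order p (pair_group p) q"
    and x: "x \<in> {0..<int p}" "fst q x = x"
  shows "q = \<one>\<^bsub>pair_group p\<^esub>"
proof -
  interpret group "pair_group p"
    by (rule group_pair_group[OF p])
  obtain k where k: "q [^]\<^bsub>pair_group p\<^esub> (p ^ k) = \<one>\<^bsub>pair_group p\<^esub>"
    using q p_power_order_iff[OF p] by blast
  have bij: "bij_betw (fst q) {0..<int p} {0..<int p}"
    using q(1) pair_group_carrier[OF p, of "fst q" "snd q"] by (auto simp: Bij_def)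
  have fst_q: "fst q y = y" if y: "y \<in> {0..<int p}" for y
  proof (rule p_power_permutation_fixed_point[where f = "fst q" and k = k, OF p _ _ _ _ _ x y])
    show "(fst q ^^ (p ^ k)) z = z" if "z \<in> {0..<int p}" for z
      using fst_pair_group_pow[OF p q(1) that, of "p ^ k"] k that by (simp add: pair_group_one_apply)
  qed (use bij in \<open>auto simp: bij_betw_def\<close>)
  \<comment> \<open>Fermat, iterated: raising to a power of \<open>p\<close> does nothing modulo \<open>p\<close>.\<close>
  have frobenius: "a ^ (p ^ j) mod int p = a mod int p" for a :: int and j
  proof (induction j)
    case (Suc j)
    have "a ^ (p ^ Suc j) mod int p = (a ^ (p ^ j)) ^ p mod int p"
      by (simp add: power_mult[symmetric] mult.commute)
    also have "\<dots> = a ^ (p ^ j) mod int p"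
      using fermat_int_power[OF p] by (simp add: mod_eq_dvd_iff)
    finally show ?case
      using Suc by simp
  qed simp
  have "snd q y = 1" if y: "y \<in> {0..<int p}" for y
  proof -
    have "snd q y = snd q y ^ (p ^ k) mod int p"
      using pair_group_maps(2)[OF p q(1) y] by (simp add: frobenius)
    also have "\<dots> = snd (q [^]\<^bsub>pair_group p\<^esub> (p ^ k)) y"
      using snd_pair_group_pow_fixed_point[OF p q(1) y fst_q[OF y]] by simp
    also have "\<dots> = 1"
      using y by (simp add: k pair_group_one_apply)
    finally show ?thesis .
  qed
  then show ?thesis
    using fst_q by (intro pair_group_eqI[OF p q(1)]) (simp_all add: pair_group_one_apply)
qed

text \<open>
  If \<open>q\<close> and \<open>r\<close> agree at \<open>x\<close>, then \<open>q\<^sup>-\<^sup>1 r\<close> fixes \<open>x\<close>.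
\<close>

lemma p_subgroup_acts_freely:
  assumes p: "prime p" and Q: "p_subgroup p (pair_group p) Q" and x: "x \<in> {0..<int p}"
  shows "inj_on (\<lambda>q. fst q x) Q"
proof (rule inj_onI)
  interpret group "pair_group p"
    by (rule group_pair_group[OF p])
  have sub: "subgroup Q (pair_group p)"
    using Q by (simp add: p_subgroup_def)
  fix q r assume q: "q \<in> Q" and r: "r \<in> Q" and eq: "fst q x = fst r x"
  let ?s = "inv\<^bsub>pair_group p\<^esub> q \<otimes>\<^bsub>pair_group p\<^esub> r"
  have carr: "q \<in> carrier (pair_group p)" "r \<in> carrier (pair_group p)"
    using q r subgroup.subset[OF sub] by auto
  have s: "?s \<in> Q"
    using q r sub by (simp add: subgroup.m_closed subgroup.m_inv_closed)
  have "fst ?s x = fst (inv\<^bsub>pair_group p\<^esub> q \<otimes>\<^bsub>pair_group p\<^esub> q) x"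
    using eq x by (simp add: pair_group_mult_apply)
  also have "\<dots> = x"
    using carr x by (simp add: pair_group_one_apply)
  finally have "?s = \<one>\<^bsub>pair_group p\<^esub>"
    using s Q subgroup.subset[OF sub] x
    by (intro pair_p_power_order_fixed_point[OF p]) (auto simp: p_subgroup_def)
  then show "q = r"
    using carr by (metis inv_closed inv_equality inv_inv)
qed

lemma p_subgroup_card_le:
  assumes p: "prime p" and Q: "p_subgroup p (pair_group p) Q"
  shows "finite Q" "card Q \<le> p"
proof -
  have "0 \<in> {0..<int p}"
    using prime_gt_0_nat[OF p] by simp
  then have inj: "inj_on (\<lambda>q. fst q 0) Q" and sub: "(\<lambda>q. fst q 0) ` Q \<subseteq> {0..<int p}"
    using p_subgroup_acts_freely[OF p Q] pair_group_maps(1)[OF p] Q subgroup.subset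
    by (fastforce simp: p_subgroup_def simp del: atLeastLessThan_iff)+
  show "finite Q"
    by (rule inj_on_finite[OF inj sub]) simp
  show "card Q \<le> p"
    using card_inj_on_le[OF inj sub] by simp
qed

lemma (in group) subgroup_of_prime_card:
  assumes "prime p" "subgroup Q G" "card Q = p" "x \<in> Q"
  shows "x [^] p = \<one>" and "x \<noteq> \<one> \<Longrightarrow> Q = generate G {x}" and "x \<noteq> \<one> \<Longrightarrow> ord x = p"
proof -
  interpret Q: group "G\<lparr>carrier := Q\<rparr>"
    by (rule subgroup.subgroup_is_group[OF assms(2) is_group])
  have x: "x \<in> carrier G"
    by (rule subgroup.mem_carrier[OF assms(2,4)])
  have "Coset.order (G\<lparr>carrier := Q\<rparr>) = p"
    using assms(3) by (simp add: Coset.order_def)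
  then have "x [^]\<^bsub>G\<lparr>carrier := Q\<rparr>\<^esub> p = \<one>\<^bsub>G\<lparr>carrier := Q\<rparr>\<^esub>"
    using Q.pow_order_eq_1[of x] assms(4) by simp
  then show pow: "x [^] p = \<one>"
    unfolding nat_pow_consistent[of x p Q] by simp
  assume "x \<noteq> \<one>"
  then have "ord x \<noteq> 1"
    using ord_eq_1[OF x] by simp
  moreover have "ord x dvd p"
    using pow pow_eq_id[OF x] by simp
  ultimately show ord: "ord x = p"
    using assms(1) unfolding prime_nat_iff by blast
  have "generate G {x} \<subseteq> Q"
    using assms(2,4) by (intro generate_subgroup_incl) auto
  moreover have "finite Q"
    using assms(3) prime_gt_0_nat[OF assms(1)] by (intro card_ge_0_finite) simp
  moreover have "card (generate G {x}) = card Q"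
    using ord generate_pow_card[OF x] assms(3) by simp
  ultimately show "Q = generate G {x}"
    by (intro card_subset_eq[symmetric])
qed

lemma subgroup_of_card_p_is_p_subgroup:
  assumes p: "prime p" and Q: "subgroup Q (pair_group p)" "card Q = p"
  shows "p_subgroup p (pair_group p) Q"
proof -
  interpret group "pair_group p"
    by (rule group_pair_group[OF p])
  have "p_power_order p (pair_group p) x" if "x \<in> Q" for x
  proof -
    have "x [^]\<^bsub>pair_group p\<^esub> (p ^ 1) = \<one>\<^bsub>pair_group p\<^esub>"
      using subgroup_of_prime_card(1)[OF p Q that] by simp
    then show ?thesis
      using p_power_order_iff[OF p subgroup.mem_carrier[OF Q(1) that]] by blast
  qed
  then show ?thesis
    using Q by (simp add: p_subgroup_def)
qed

text \<open>
  The order is at most \<open>p\<close> by freeness, and at least \<open>p\<close> because a nontrivial element of \<open>p\<close>-power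
  order generates at least \<open>p\<close> elements.
\<close>

lemma p_subgroup_trivial_or_card:
  assumes p: "prime p" and Q: "p_subgroup p (pair_group p) Q"
  shows "Q = {\<one>\<^bsub>pair_group p\<^esub>} \<or> card Q = p"
proof (cases "Q = {\<one>\<^bsub>pair_group p\<^esub>}")
  case False
  interpret group "pair_group p"
    by (rule group_pair_group[OF p])
  have sub: "subgroup Q (pair_group p)"
    using Q by (simp add: p_subgroup_def)
  have "\<one>\<^bsub>pair_group p\<^esub> \<in> Q"
    by (rule subgroup.one_closed[OF sub])
  then obtain x where x: "x \<in> Q" "x \<noteq> \<one>\<^bsub>pair_group p\<^esub>"
    using False by blast
  have xc: "x \<in> carrier (pair_group p)"
    by (rule subgroup.mem_carrier[OF sub x(1)])
  obtain k where k: "ord x = p ^ k"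
    using Q x by (auto simp: p_subgroup_def p_power_order_def)
  moreover have "k \<noteq> 0"
    using k x ord_eq_1[OF xc] by auto
  ultimately have "p \<le> ord x"
    using prime_gt_1_nat[OF p] by (simp add: self_le_power)
  also have "\<dots> = card (generate (pair_group p) {x})"
    by (rule generate_pow_card[OF xc])
  also have "\<dots> \<le> card Q"
    using sub x p_subgroup_card_le(1)[OF p Q] by (intro card_mono generate_subgroup_incl) auto
  finally show ?thesis
    using p_subgroup_card_le(2)[OF p Q] by simp
qed simp

lemma card_p_subgroup_simply_transitive:
  assumes p: "prime p" and Q: "subgroup Q (pair_group p)" "card Q = p" and x: "x \<in> {0..<int p}"
  shows "bij_betw (\<lambda>q. fst q x) Q {0..<int p}"
proof -
  have inj: "inj_on (\<lambda>q. fst q x) Q"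
    by (rule p_subgroup_acts_freely[OF p subgroup_of_card_p_is_p_subgroup[OF p Q] x])
  moreover have "(\<lambda>q. fst q x) ` Q = {0..<int p}"
  proof (rule card_subset_eq)
    show "(\<lambda>q. fst q x) ` Q \<subseteq> {0..<int p}"
      using pair_group_maps(1)[OF p _ x] subgroup.subset[OF Q(1)] by blast
    show "card ((\<lambda>q. fst q x) ` Q) = card {0..<int p}"
      using card_image[OF inj] Q(2) by simp
  qed simp
  ultimately show ?thesis
    by (simp add: bij_betw_def)
qed

text \<open>
  Some subgroup of order \<open>p\<close> must be known to exist, for otherwise the trivial subgroup would
  be maximal.
\<close>

lemma sylow_subgroup_pair_group_iff:
  assumes p: "prime p" and ex: "\<exists>P. subgroup P (pair_group p) \<and> card P = p"
  shows "sylow_subgroup p (pair_group p) P \<longleftrightarrow> subgroup P (pair_group p) \<and> card P = p"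
proof
  assume P: "sylow_subgroup p (pair_group p) P"
  then have pP: "p_subgroup p (pair_group p) P"
    by (simp add: sylow_subgroup_def)
  obtain R where R: "subgroup R (pair_group p)" "card R = p"
    using ex by blast
  have "P \<noteq> {\<one>\<^bsub>pair_group p\<^esub>}"
  proof
    assume triv: "P = {\<one>\<^bsub>pair_group p\<^esub>}"
    then have "P \<subseteq> R"
      using subgroup.one_closed[OF R(1)] by simp
    then have "R = P"
      using P subgroup_of_card_p_is_p_subgroup[OF p R] by (simp add: sylow_subgroup_def)
    then show False
      using triv R(2) prime_gt_1_nat[OF p] by simp
  qed
  then show "subgroup P (pair_group p) \<and> card P = p"
    using p_subgroup_trivial_or_card[OF p pP] pP by (auto simp: p_subgroup_def)
next
  assume P: "subgroup P (pair_group p) \<and> card P = p"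
  then have pP: "p_subgroup p (pair_group p) P"
    using subgroup_of_card_p_is_p_subgroup[OF p] by blast
  moreover have "Q = P" if "p_subgroup p (pair_group p) Q" "P \<subseteq> Q" for Q
    using p_subgroup_card_le[OF p that(1)] that(2) P by (metis card_seteq)
  ultimately show "sylow_subgroup p (pair_group p) P"
    by (auto simp: sylow_subgroup_def)
qed

section \<open>Subgroups of order p of the group of pairs\<close>

text \<open>
  The explicit subgroup belonging to \<open>C\<close> and \<open>\<phi>\<close>, with the quotient \<open>\<phi> (f x) / \<phi> x\<close> cleared of its
  denominator. It is the conjugate by the pair of the identity and \<open>\<phi>\<close> of the copy of \<open>C\<close>
  consisting of the pairs with second component \<open>1\<close>.
\<close>

definition cocycle_subgroup ::
  "nat \<Rightarrow> (int \<Rightarrow> int) set \<Rightarrow> (int \<Rightarrow> int) \<Rightarrow> ((int \<Rightarrow> int) \<times> (int \<Rightarrow> int)) set" where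
  "cocycle_subgroup p C \<phi> =
     {q \<in> carrier (pair_group p). fst q \<in> C \<and>
        (\<forall>x\<in>{0..<int p}. snd q x * \<phi> x mod int p = \<phi> (fst q x))}"

lemma mult_mod_prime_cancel:
  assumes p: "prime p" and ab: "a \<in> {0..<int p}" "b \<in> {0..<int p}" and c: "c \<in> {0<..<int p}"
    and eq: "a * c mod int p = b * c mod int p"
  shows "a = b"
proof -
  have "int p dvd (a - b) * c"
    using eq by (simp add: mod_eq_dvd_iff left_diff_distrib)
  moreover have "\<not> int p dvd c"
    using c zdvd_not_zless by auto
  ultimately have "int p dvd a - b"
    using p by (simp add: prime_dvd_mult_iff)
  then have "a mod int p = b mod int p"
    by (simp add: mod_eq_dvd_iff)
  then show ?thesis
    using ab by simp
qed

lemma ex_quotient_mod_prime: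
  assumes p: "prime p" and a: "a \<in> {0<..<int p}" and b: "b \<in> {0<..<int p}"
  shows "\<exists>c\<in>{0<..<int p}. c * b mod int p = a"
proof -
  obtain y where y: "b * y mod int p = 1"
    using ex_inverse_mod_prime[OF p b] by blast
  define c where "c = a * y mod int p"
  have "c * b mod int p = a * (b * y mod int p) mod int p"
    by (simp add: c_def mod_mult_left_eq mod_mult_right_eq ac_simps)
  then have cb: "c * b mod int p = a"
    using a by (simp add: y)
  moreover have "0 \<le> c" "c < int p"
    using prime_gt_0_nat[OF p] by (simp_all add: c_def)
  moreover have "c \<noteq> 0"
    using cb a by auto
  ultimately show ?thesis
    by (intro bexI[of _ c]) simp_all
qed

lemma explicit_sylow_eq_cocycle_subgroup:
  assumes p: "prime p" and \<phi>: "\<phi> \<in> nonzero_maps p"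
  shows "explicit_sylow p C (scalar_rel p `` {\<phi>}) = cocycle_subgroup p C \<phi>"
proof -
  interpret residues_prime p "Zp p"
    using p by unfold_locales simp_all
  interpret field "Zp p"
    by (rule is_field)
  have ratio: "c = a \<otimes>\<^bsub>Zp p\<^esub> inv\<^bsub>Zp p\<^esub> b \<longleftrightarrow> c * b mod int p = a"
    if "a \<in> {0<..<int p}" "b \<in> {0<..<int p}" "c \<in> {0<..<int p}" for a b c
  proof -
    have abc: "a \<in> carrier (Zp p)" "b \<in> carrier (Zp p)" "c \<in> carrier (Zp p)" "b \<in> Units (Zp p)"
      using that field_Units by (auto simp: residue_ring_def)
    then have "c = a \<otimes>\<^bsub>Zp p\<^esub> inv\<^bsub>Zp p\<^esub> b \<longleftrightarrow> c \<otimes>\<^bsub>Zp p\<^esub> b = a"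
      by (metis Units_inv_closed Units_l_inv Units_r_inv m_assoc r_one)
    then show ?thesis
      by (simp add: residue_ring_def)
  qed
  have *: "(\<forall>x\<in>{0..<int p}. f' x = \<phi> (f x) \<otimes>\<^bsub>Zp p\<^esub> inv\<^bsub>Zp p\<^esub> (\<phi> x)) \<longleftrightarrow>
      (\<forall>x\<in>{0..<int p}. f' x * \<phi> x mod int p = \<phi> (f x))"
    if "(f, f') \<in> carrier (pair_group p)" for f f'
  proof (rule ball_cong[OF refl])
    fix x assume x: "x \<in> {0..<int p}"
    have "\<phi> (f x) \<in> {0<..<int p}" "\<phi> x \<in> {0<..<int p}" "f' x \<in> {0<..<int p}"
      using \<phi> pair_group_maps[OF p that x] x
      by (auto simp: nonzero_maps_iff PiE_iff simp del: atLeastLessThan_iff greaterThanLessThan_iff)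
    then show "f' x = \<phi> (f x) \<otimes>\<^bsub>Zp p\<^esub> inv\<^bsub>Zp p\<^esub> (\<phi> x) \<longleftrightarrow> f' x * \<phi> x mod int p = \<phi> (f x)"
      by (rule ratio)
  qed
  show ?thesis
  proof (rule Set.set_eqI)
    fix q
    show "q \<in> explicit_sylow p C (scalar_rel p `` {\<phi>}) \<longleftrightarrow> q \<in> cocycle_subgroup p C \<phi>"
      using *[of "fst q" "snd q"]
      unfolding explicit_sylow_class[OF p \<phi>] cocycle_subgroup_def carrier_residue_ring
      by (cases q) (simp del: atLeastLessThan_iff cong: conj_cong)
  qed
qed

lemma finite_pair_group:
  assumes "prime p"
  shows "finite (carrier (pair_group p))"
proof (rule finite_subset)
  show "carrier (pair_group p) \<subseteq> carrier (pair_monoid p)"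
    by (auto simp: pair_group_def units_of_carrier Units_def)
qed (simp add: pair_monoid_carrier finite_PiE)

text \<open>
  The ratios \<open>\<phi> (f x) / \<phi> x\<close> telescope along a composition.
\<close>

lemma subgroup_cocycle_subgroup:
  assumes p: "prime p" and C: "subgroup C (BijGroup {0..<int p})" and \<phi>: "\<phi> \<in> nonzero_maps p"
  shows "subgroup (cocycle_subgroup p C \<phi>) (pair_group p)"
proof -
  interpret group_hom "pair_group p" "BijGroup {0..<int p}" fst
    by (rule group_hom_fst_pair_group[OF p])
  have \<phi>_mod: "\<phi> x mod int p = \<phi> x" if "x \<in> {0..<int p}" for x
    using PiE_mem[OF \<phi>[unfolded nonzero_maps_iff] that] by simp
  show ?thesis
  proof (rule G.finite_submonoid_is_subgroup[OF finite_pair_group[OF p]])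
    have "fst \<one>\<^bsub>pair_group p\<^esub> \<in> C"
      using subgroup.one_closed[OF C] by simp
    then show "\<one>\<^bsub>pair_group p\<^esub> \<in> cocycle_subgroup p C \<phi>"
      by (simp add: cocycle_subgroup_def pair_group_one_apply \<phi>_mod del: hom_one atLeastLessThan_iff)
  next
    fix q r assume q: "q \<in> cocycle_subgroup p C \<phi>" and r: "r \<in> cocycle_subgroup p C \<phi>"
    then have carr: "q \<in> carrier (pair_group p)" "r \<in> carrier (pair_group p)"
      by (simp_all add: cocycle_subgroup_def)
    have "fst (q \<otimes>\<^bsub>pair_group p\<^esub> r) \<in> C"
      using q r subgroup.m_closed[OF C] by (simp add: cocycle_subgroup_def)
    moreover have "snd (q \<otimes>\<^bsub>pair_group p\<^esub> r) x * \<phi> x mod int p = \<phi> (fst (q \<otimes>\<^bsub>pair_group p\<^esub> r) x)"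
      if x: "x \<in> {0..<int p}" for x
    proof -
      have "snd (q \<otimes>\<^bsub>pair_group p\<^esub> r) x * \<phi> x mod int p =
          snd q (fst r x) * (snd r x * \<phi> x mod int p) mod int p"
        unfolding pair_group_mult_apply(2)[OF x] by (simp add: mod_mult_left_eq mod_mult_right_eq mult.assoc)
      also have "\<dots> = \<phi> (fst q (fst r x))"
        using q r x pair_group_maps(1)[OF p carr(2) x] by (simp add: cocycle_subgroup_def)
      also have "\<dots> = \<phi> (fst (q \<otimes>\<^bsub>pair_group p\<^esub> r) x)"
        unfolding pair_group_mult_apply(1)[OF x] ..
      finally show ?thesis .
    qed
    ultimately show "q \<otimes>\<^bsub>pair_group p\<^esub> r \<in> cocycle_subgroup p C \<phi>"
      using carr unfolding cocycle_subgroup_def by blast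
  qed (auto simp: cocycle_subgroup_def)
qed

text \<open>
  The equation for the second component is uniquely solvable because \<open>\<phi>\<close> is nowhere zero.
\<close>

lemma bij_betw_fst_cocycle_subgroup:
  assumes p: "prime p" and C: "C \<subseteq> Bij {0..<int p}" and \<phi>: "\<phi> \<in> nonzero_maps p"
  shows "bij_betw fst (cocycle_subgroup p C \<phi>) C"
proof -
  have \<phi>_range: "\<phi> x \<in> {0<..<int p}" if "x \<in> {0..<int p}" for x
    using PiE_mem[OF \<phi>[unfolded nonzero_maps_iff] that] .
  have in_Z: "a \<in> {0..<int p}" if "a \<in> {0<..<int p}" for a
    using that by simp
  have "inj_on fst (cocycle_subgroup p C \<phi>)"
  proof (rule inj_onI)
    fix q r assume q: "q \<in> cocycle_subgroup p C \<phi>" and r: "r \<in> cocycle_subgroup p C \<phi>"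
      and eq: "fst q = fst r"
    then have carr: "q \<in> carrier (pair_group p)" "r \<in> carrier (pair_group p)"
      by (simp_all add: cocycle_subgroup_def)
    have "snd q x = snd r x" if x: "x \<in> {0..<int p}" for x
    proof (rule mult_mod_prime_cancel[OF p _ _ \<phi>_range[OF x]])
      show "snd q x * \<phi> x mod int p = snd r x * \<phi> x mod int p"
        using q r x eq by (simp add: cocycle_subgroup_def)
    qed (intro in_Z pair_group_maps(2)[OF p _ x] carr)+
    then show "q = r"
      using eq by (intro pair_group_eqI[OF p carr]) simp_all
  qed
  moreover have "C \<subseteq> fst ` cocycle_subgroup p C \<phi>"
  proof
    fix f assume f: "f \<in> C"
    have fx: "f x \<in> {0..<int p}" if "x \<in> {0..<int p}" for x
      using f C that Bij_imp_funcset by blast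
    have "\<forall>x\<in>{0..<int p}. \<exists>c\<in>{0<..<int p}. c * \<phi> x mod int p = \<phi> (f x)"
      using ex_quotient_mod_prime[OF p \<phi>_range[OF fx] \<phi>_range] by blast
    then obtain c where c: "\<And>x. x \<in> {0..<int p} \<Longrightarrow> c x \<in> {0<..<int p} \<and> c x * \<phi> x mod int p = \<phi> (f x)"
      by metis
    define f' where "f' = (\<lambda>x\<in>{0..<int p}. c x)"
    have "(f, f') \<in> carrier (pair_group p)"
      using f C c by (auto simp: pair_group_carrier[OF p] f'_def simp del: atLeastLessThan_iff greaterThanLessThan_iff)
    then have "(f, f') \<in> cocycle_subgroup p C \<phi>"
      using f c by (simp add: cocycle_subgroup_def f'_def)
    then show "f \<in> fst ` cocycle_subgroup p C \<phi>"
      by force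
  qed
  ultimately show ?thesis
    by (auto simp: bij_betw_def cocycle_subgroup_def)
qed

lemma card_cocycle_subgroup:
  assumes p: "prime p" and C: "subgroup C (BijGroup {0..<int p})" and \<phi>: "\<phi> \<in> nonzero_maps p"
  shows "card (cocycle_subgroup p C \<phi>) = card C"
  using bij_betw_same_card[OF bij_betw_fst_cocycle_subgroup[OF p _ \<phi>]] subgroup.subset[OF C]
  by (simp add: carrier_BijGroup)

text \<open>
  A permutation group of order \<open>p\<close> lifts to a subgroup of order \<open>p\<close> of the group of pairs with
  \<open>\<phi> = 1\<close>, where simple transitivity is already known.
\<close>

lemma card_p_permutation_group_simply_transitive:
  assumes p: "prime p" and C: "subgroup C (BijGroup {0..<int p})" "card C = p"
    and x: "x \<in> {0..<int p}"
  shows "bij_betw (\<lambda>f. f x) C {0..<int p}"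
proof -
  define \<phi> where "\<phi> = (\<lambda>x\<in>{0..<int p}. 1 :: int)"
  have \<phi>: "\<phi> \<in> nonzero_maps p"
    using prime_gt_1_nat[OF p] by (auto simp: nonzero_maps_iff \<phi>_def)
  have "C \<subseteq> Bij {0..<int p}"
    using subgroup.subset[OF C(1)] by (simp add: carrier_BijGroup)
  note fst = bij_betw_fst_cocycle_subgroup[OF p this \<phi>]
  have "bij_betw (\<lambda>q. fst q x) (cocycle_subgroup p C \<phi>) {0..<int p}"
    using C card_cocycle_subgroup[OF p C(1) \<phi>]
    by (intro card_p_subgroup_simply_transitive[OF p subgroup_cocycle_subgroup[OF p C(1) \<phi>] _ x]) simp
  then show ?thesis
    using bij_betw_comp_iff[OF fst, of "\<lambda>f. f x"] by (simp add: comp_def)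
qed

text \<open>
  In the proof \<open>e y\<close> is the unique element of \<open>P\<close> taking \<open>0\<close> to \<open>y\<close>. For \<open>q \<in> P\<close> uniqueness gives
  \<open>e (fst q x) = q \<otimes> e x\<close>; comparing second components at \<open>0\<close> is the required equation for
  \<open>\<phi> y = snd (e y) 0\<close>. Both subgroups have order \<open>p\<close>, so the inclusion is an equality.
\<close>

lemma card_p_subgroup_is_cocycle_subgroup:
  assumes p: "prime p" and P: "subgroup P (pair_group p)" "card P = p"
  obtains C \<phi> where "subgroup C (BijGroup {0..<int p})" "card C = p"
    "\<phi> \<in> nonzero_maps p" "\<phi> 0 = 1" "P = cocycle_subgroup p C \<phi>"
proof -
  interpret group_hom "pair_group p" "BijGroup {0..<int p}" fst
    by (rule group_hom_fst_pair_group[OF p])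
  have zero: "0 \<in> {0..<int p}"
    using prime_gt_0_nat[OF p] by simp
  have carr: "q \<in> carrier (pair_group p)" if "q \<in> P" for q
    by (rule subgroup.mem_carrier[OF P(1) that])
  have bij: "bij_betw (\<lambda>q. fst q 0) P {0..<int p}"
    by (rule card_p_subgroup_simply_transitive[OF p P zero])
  define e where "e = inv_into P (\<lambda>q. fst q 0)"
  have e: "e y \<in> P" "fst (e y) 0 = y" if "y \<in> {0..<int p}" for y
  proof -
    have "y \<in> (\<lambda>q. fst q 0) ` P"
      using that bij_betw_imp_surj_on[OF bij] by simp
    then show "e y \<in> P" "fst (e y) 0 = y"
      unfolding e_def by (rule inv_into_into, rule f_inv_into_f)
  qed
  have e_unique: "e (fst q 0) = q" if "q \<in> P" for q
    using bij_betw_inv_into_left[OF bij that] by (simp add: e_def)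
  define \<phi> where "\<phi> = (\<lambda>y\<in>{0..<int p}. snd (e y) 0)"
  have \<phi>: "\<phi> \<in> nonzero_maps p"
    using pair_group_maps(2)[OF p carr[OF e(1)] zero]
    by (auto simp: nonzero_maps_iff \<phi>_def simp del: atLeastLessThan_iff greaterThanLessThan_iff)
  \<comment> \<open>The unit of \<open>P\<close> takes \<open>0\<close> to \<open>0\<close>, so it is \<open>e 0\<close>; this normalises \<open>\<phi>\<close>.\<close>
  have "e 0 = \<one>\<^bsub>pair_group p\<^esub>"
    using e_unique[OF subgroup.one_closed[OF P(1)]] zero by (simp add: pair_group_one_apply del: hom_one)
  then have \<phi>0: "\<phi> 0 = 1"
    using zero by (simp add: \<phi>_def pair_group_one_apply)
  have C: "subgroup (fst ` P) (BijGroup {0..<int p})"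
    by (rule subgroup_img_is_subgroup[OF P(1)])
  have "inj_on ((\<lambda>f. f 0) \<circ> fst) P"
    using bij by (simp add: bij_betw_def comp_def)
  then have "card (fst ` P) = p"
    using P(2) card_image inj_on_imageI2 by metis
  moreover have "P \<subseteq> cocycle_subgroup p (fst ` P) \<phi>"
  proof
    fix q assume q: "q \<in> P"
    have "snd q x * \<phi> x mod int p = \<phi> (fst q x)" if x: "x \<in> {0..<int p}" for x
    proof -
      let ?r = "q \<otimes>\<^bsub>pair_group p\<^esub> e x"
      have "fst ?r 0 = fst q x"
        using e(2)[OF x] zero by (simp add: pair_group_mult_apply)
      then have "e (fst q x) = ?r"
        using e_unique[OF subgroup.m_closed[OF P(1) q e(1)[OF x]]] by simp
      then have "\<phi> (fst q x) = snd ?r 0"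
        using pair_group_maps(1)[OF p carr[OF q] x] by (simp add: \<phi>_def)
      then show ?thesis
        using e(2)[OF x] x zero by (simp add: pair_group_mult_apply \<phi>_def)
    qed
    then show "q \<in> cocycle_subgroup p (fst ` P) \<phi>"
      using q carr[OF q] by (simp add: cocycle_subgroup_def)
  qed
  moreover have "finite (cocycle_subgroup p (fst ` P) \<phi>)"
    by (rule finite_subset[OF _ finite_pair_group[OF p]]) (auto simp: cocycle_subgroup_def)
  ultimately have "P = cocycle_subgroup p (fst ` P) \<phi>"
    using P(2) card_cocycle_subgroup[OF p C \<phi>] by (intro card_subset_eq) simp_all
  then show thesis
    using that[OF C \<open>card (fst ` P) = p\<close> \<phi> \<phi>0] by blast
qed

text \<open>
  The group determines \<open>C\<close> as its first projection, and by transitivity it determines every ratio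
  \<open>\<phi> y / \<phi> 0\<close>.
\<close>

lemma cocycle_subgroup_inject:
  assumes p: "prime p"
    and C: "subgroup C (BijGroup {0..<int p})" "card C = p" and \<phi>: "\<phi> \<in> nonzero_maps p" "\<phi> 0 = 1"
    and D: "subgroup D (BijGroup {0..<int p})" "card D = p" and \<chi>: "\<chi> \<in> nonzero_maps p" "\<chi> 0 = 1"
    and eq: "cocycle_subgroup p C \<phi> = cocycle_subgroup p D \<chi>"
  shows "C = D \<and> \<phi> = \<chi>"
proof
  let ?S = "cocycle_subgroup p C \<phi>"
  have "C \<subseteq> Bij {0..<int p}" "D \<subseteq> Bij {0..<int p}"
    using subgroup.subset[OF C(1)] subgroup.subset[OF D(1)] by (simp_all add: carrier_BijGroup)
  then show "C = D"
    using bij_betw_fst_cocycle_subgroup[OF p _ \<phi>(1)] bij_betw_fst_cocycle_subgroup[OF p _ \<chi>(1)] eq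
    by (metis bij_betw_imp_surj_on)
  have zero: "0 \<in> {0..<int p}"
    using prime_gt_0_nat[OF p] by simp
  have bij: "bij_betw (\<lambda>q. fst q 0) ?S {0..<int p}"
    using C card_cocycle_subgroup[OF p C(1) \<phi>(1)]
    by (intro card_p_subgroup_simply_transitive[OF p subgroup_cocycle_subgroup[OF p C(1) \<phi>(1)] _ zero]) simp
  show "\<phi> = \<chi>"
  proof (rule extensionalityI)
    fix y assume "y \<in> {0..<int p}"
    then have "y \<in> (\<lambda>q. fst q 0) ` ?S"
      using bij_betw_imp_surj_on[OF bij] by simp
    then obtain q where q: "q \<in> ?S" "fst q 0 = y"
      by blast
    have "snd q 0 * \<phi> 0 mod int p = \<phi> (fst q 0)"
      using q(1) zero unfolding cocycle_subgroup_def by blast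
    moreover have "snd q 0 * \<chi> 0 mod int p = \<chi> (fst q 0)"
      using q(1)[unfolded eq] zero unfolding cocycle_subgroup_def by blast
    ultimately show "\<phi> y = \<chi> y"
      using \<phi>(2) \<chi>(2) q(2) by simp
  qed (use \<phi> \<chi> in \<open>auto simp: nonzero_maps_iff PiE_iff\<close>)
qed

lemma (in group) prime_card_imp_cyclic:
  assumes p: "prime p" and Q: "subgroup Q G" "card Q = p"
  shows "cyclic_group (G\<lparr>carrier := Q\<rparr>)"
proof -
  let ?K = "G\<lparr>carrier := Q\<rparr>"
  interpret K: group ?K
    by (rule subgroup.subgroup_is_group[OF Q(1) is_group])
  have "Q \<noteq> {\<one>}"
    using Q(2) prime_gt_1_nat[OF p] by auto
  then obtain x where x: "x \<in> Q" "x \<noteq> \<one>"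
    using subgroup.one_closed[OF Q(1)] by blast
  have "Q = generate ?K {x}"
    using K.subgroup_of_prime_card(2)[OF p K.subgroup_self, of x] Q(2) x by simp
  then have "subgroup_generated ?K {x} = ?K"
    using x(1) by (simp add: subgroup_generated_def)
  then show ?thesis
    using x(1) unfolding cyclic_group_def by auto
qed

lemma order_p_cyclic_subgroups_eq:
  assumes p: "prime p"
  shows "order_p_cyclic_subgroups p = {C. subgroup C (BijGroup {0..<int p}) \<and> card C = p}"
  using group.prime_card_imp_cyclic[OF group_BijGroup p]
  by (auto simp: order_p_cyclic_subgroups_def carrier_residue_ring)

section \<open>Permutation groups of order p\<close>

text \<open>
  The \<open>i\<close>-th power of the cycle obtained from \<open>x \<mapsto> x + 1\<close> by conjugation with \<open>\<sigma>\<close>. The exponent is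
  an integer so that negative exponents give inverses.
\<close>

definition conjugated_shift :: "nat \<Rightarrow> (int \<Rightarrow> int) \<Rightarrow> int \<Rightarrow> int \<Rightarrow> int" where
  "conjugated_shift p \<sigma> i = (\<lambda>x\<in>{0..<int p}. \<sigma> ((inv_into UNIV \<sigma> x + i) mod int p))"

text \<open>
  Each group of order \<open>p\<close> arises from \<open>p * (p - 1)\<close> conjugating permutations; requiring that
  \<open>\<sigma>\<close> fixes \<open>0\<close> and \<open>1\<close> singles out one of them.
\<close>

context
  fixes p :: nat and \<sigma> :: "int \<Rightarrow> int"
  assumes p: "prime p" and \<sigma>: "\<sigma> permutes {2..<int p}"
begin

lemma permutes_residues: "\<sigma> permutes {0..<int p}"
  by (rule permutes_subset[OF \<sigma>]) auto

lemma permutes_mod_in_residues: "\<sigma> (a mod int p) \<in> {0..<int p}"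
  using permutes_in_image[OF permutes_residues, of "a mod int p"] prime_gt_0_nat[OF p] by simp

lemma permutes_01: "\<sigma> 0 = 0" "\<sigma> 1 = 1" "inv_into UNIV \<sigma> 0 = 0"
proof -
  show "\<sigma> 0 = 0" "\<sigma> 1 = 1"
    using permutes_not_in[OF \<sigma>] by simp_all
  then show "inv_into UNIV \<sigma> 0 = 0"
    using permutes_inverses(2)[OF \<sigma>, of 0] by simp
qed

lemma conjugated_shift_in_residues:
  "x \<in> {0..<int p} \<Longrightarrow> conjugated_shift p \<sigma> i x \<in> {0..<int p}"
  unfolding conjugated_shift_def using permutes_mod_in_residues by (simp del: atLeastLessThan_iff)

lemma conjugated_shift_compose:
  "compose {0..<int p} (conjugated_shift p \<sigma> i) (conjugated_shift p \<sigma> j) = conjugated_shift p \<sigma> (i + j)"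
proof
  fix x
  show "compose {0..<int p} (conjugated_shift p \<sigma> i) (conjugated_shift p \<sigma> j) x = conjugated_shift p \<sigma> (i + j) x"
  proof (cases "x \<in> {0..<int p}")
    case True
    have "((inv_into UNIV \<sigma> x + j) mod int p + i) mod int p = (inv_into UNIV \<sigma> x + (i + j)) mod int p"
      by (simp add: mod_add_right_eq ac_simps)
    then show ?thesis
      using True permutes_mod_in_residues[of "inv_into UNIV \<sigma> x + j"] permutes_inverses(2)[OF \<sigma>]
      by (simp add: compose_def conjugated_shift_def del: atLeastLessThan_iff)
  qed (simp add: compose_def conjugated_shift_def del: atLeastLessThan_iff)
qed

lemma conjugated_shift_0: "conjugated_shift p \<sigma> 0 = (\<lambda>x\<in>{0..<int p}. x)"
proof
  fix x
  show "conjugated_shift p \<sigma> 0 x = (\<lambda>x\<in>{0..<int p}. x) x"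
  proof (cases "x \<in> {0..<int p}")
    case True
    then have "inv_into UNIV \<sigma> x \<in> {0..<int p}"
      using permutes_in_image[OF permutes_inv[OF permutes_residues]] by blast
    then show ?thesis
      using True permutes_inverses(1)[OF \<sigma>] by (simp add: conjugated_shift_def)
  qed (simp add: conjugated_shift_def del: atLeastLessThan_iff)
qed

lemma conjugated_shift_mod: "conjugated_shift p \<sigma> (i mod int p) = conjugated_shift p \<sigma> i"
  by (simp add: conjugated_shift_def mod_add_right_eq)

lemma conjugated_shift_apply_0: "conjugated_shift p \<sigma> i 0 = \<sigma> (i mod int p)"
  using prime_gt_0_nat[OF p] by (simp add: conjugated_shift_def permutes_01)

lemma conjugated_shift_Bij: "conjugated_shift p \<sigma> i \<in> Bij {0..<int p}"
proof -
  have cancel: "conjugated_shift p \<sigma> j (conjugated_shift p \<sigma> k x) = x"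
    if "j + k = 0" "x \<in> {0..<int p}" for j k x
    using fun_cong[OF conjugated_shift_compose[of j k], of x] that
    by (simp add: compose_def conjugated_shift_0)
  have "bij_betw (conjugated_shift p \<sigma> i) {0..<int p} {0..<int p}"
    by (rule bij_betw_byWitness[of _ "conjugated_shift p \<sigma> (- i)"])
      (use cancel[of i "- i"] cancel[of "- i" i] conjugated_shift_in_residues
        in \<open>auto simp del: atLeastLessThan_iff\<close>)
  then show ?thesis
    by (simp add: Bij_def conjugated_shift_def)
qed

lemma subgroup_range_conjugated_shift:
  "subgroup (range (conjugated_shift p \<sigma>)) (BijGroup {0..<int p})"
proof (rule group.finite_submonoid_is_subgroup[OF group_BijGroup finite_BijGroup])
  show "range (conjugated_shift p \<sigma>) \<subseteq> carrier (BijGroup {0..<int p})"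
    using conjugated_shift_Bij by (auto simp: carrier_BijGroup)
  have "\<one>\<^bsub>BijGroup {0..<int p}\<^esub> = conjugated_shift p \<sigma> 0"
    by (simp add: BijGroup_def conjugated_shift_0)
  then show "\<one>\<^bsub>BijGroup {0..<int p}\<^esub> \<in> range (conjugated_shift p \<sigma>)"
    by simp
next
  fix f g assume "f \<in> range (conjugated_shift p \<sigma>)" "g \<in> range (conjugated_shift p \<sigma>)"
  then obtain i j where "f = conjugated_shift p \<sigma> i" "g = conjugated_shift p \<sigma> j"
    by blast
  then have "f \<otimes>\<^bsub>BijGroup {0..<int p}\<^esub> g = conjugated_shift p \<sigma> (i + j)"
    by (simp add: BijGroup_mult conjugated_shift_Bij conjugated_shift_compose)
  then show "f \<otimes>\<^bsub>BijGroup {0..<int p}\<^esub> g \<in> range (conjugated_shift p \<sigma>)"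
    by simp
qed simp

lemma card_range_conjugated_shift: "card (range (conjugated_shift p \<sigma>)) = p"
proof -
  have "i mod int p \<in> {0..<int p}" for i
    using prime_gt_0_nat[OF p] by simp
  then have "range (conjugated_shift p \<sigma>) = conjugated_shift p \<sigma> ` {0..<int p}"
    by (metis (no_types, lifting) conjugated_shift_mod image_subset_iff image_eqI subset_antisym subset_UNIV image_mono)
  moreover have "inj_on (conjugated_shift p \<sigma>) {0..<int p}"
  proof (rule inj_onI)
    fix i j assume ij: "i \<in> {0..<int p}" "j \<in> {0..<int p}"
      and "conjugated_shift p \<sigma> i = conjugated_shift p \<sigma> j"
    then have "\<sigma> (i mod int p) = \<sigma> (j mod int p)"
      by (metis conjugated_shift_apply_0)
    then show "i = j"
      using ij permutes_inj[OF \<sigma>] by (simp add: inj_eq)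
  qed
  ultimately show ?thesis
    by (simp add: card_image)
qed

lemma conjugated_shift_1_unique:
  assumes "f \<in> range (conjugated_shift p \<sigma>)" "f 0 = 1"
  shows "f = conjugated_shift p \<sigma> 1"
proof -
  obtain i where i: "f = conjugated_shift p \<sigma> i"
    using assms(1) by blast
  then have "\<sigma> (i mod int p) = \<sigma> 1"
    using assms(2) by (simp add: conjugated_shift_apply_0 permutes_01)
  then have "i mod int p = 1"
    using permutes_inj[OF \<sigma>] by (simp add: inj_eq)
  then show ?thesis
    using conjugated_shift_mod[of i] i by simp
qed

lemma conjugated_shift_1_funpow:
  "(conjugated_shift p \<sigma> 1 ^^ k) 0 = \<sigma> (int k mod int p)"
proof -
  have "(conjugated_shift p \<sigma> 1 ^^ k) 0 = conjugated_shift p \<sigma> (int k) 0"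
  proof (induction k)
    case 0
    then show ?case
      using prime_gt_0_nat[OF p] by (simp add: conjugated_shift_0)
  next
    case (Suc k)
    then show ?case
      using fun_cong[OF conjugated_shift_compose[of 1 "int k"], of 0] prime_gt_0_nat[OF p]
      by (simp add: compose_def)
  qed
  then show ?thesis
    by (simp add: conjugated_shift_apply_0)
qed

end

text \<open>
  Because \<open>\<sigma>\<close> fixes \<open>0\<close> and \<open>1\<close>, the generator with exponent \<open>1\<close> is the only element of the group
  taking \<open>0\<close> to \<open>1\<close>, and \<open>\<sigma>\<close> lists its iterates at \<open>0\<close>.
\<close>

lemma inj_on_range_conjugated_shift:
  assumes p: "prime p"
  shows "inj_on (\<lambda>\<sigma>. range (conjugated_shift p \<sigma>)) {\<sigma>. \<sigma> permutes {2..<int p}}"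
proof (rule inj_onI)
  fix \<sigma> \<tau>
  assume "\<sigma> \<in> {\<sigma>. \<sigma> permutes {2..<int p}}" "\<tau> \<in> {\<sigma>. \<sigma> permutes {2..<int p}}"
    and eq: "range (conjugated_shift p \<sigma>) = range (conjugated_shift p \<tau>)"
  then have \<sigma>: "\<sigma> permutes {2..<int p}" and \<tau>: "\<tau> permutes {2..<int p}"
    by simp_all
  have "1 mod int p = 1"
    using prime_gt_1_nat[OF p] by simp
  then have "conjugated_shift p \<sigma> 1 0 = 1"
    by (simp add: conjugated_shift_apply_0[OF p \<sigma>] permutes_01[OF p \<sigma>])
  moreover have "conjugated_shift p \<sigma> 1 \<in> range (conjugated_shift p \<tau>)"
    unfolding eq[symmetric] by simp
  ultimately have gen: "conjugated_shift p \<sigma> 1 = conjugated_shift p \<tau> 1"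
    by (intro conjugated_shift_1_unique[OF p \<tau>])
  show "\<sigma> = \<tau>"
  proof
    fix x
    show "\<sigma> x = \<tau> x"
    proof (cases "x \<in> {0..<int p}")
      case True
      then have "int (nat x) mod int p = x"
        by simp
      then show ?thesis
        using conjugated_shift_1_funpow[OF p \<sigma>, of "nat x"]
          conjugated_shift_1_funpow[OF p \<tau>, of "nat x"] gen by simp
    next
      case False
      then show ?thesis
        using permutes_not_in[OF permutes_residues[OF p \<sigma>]]
          permutes_not_in[OF permutes_residues[OF p \<tau>]] by simp
    qed
  qed
qed

text \<open>
  Let \<open>f\<close> be the element of \<open>C\<close> with \<open>f 0 = 1\<close>. It generates \<open>C\<close>, so transitivity makes
  \<open>\<sigma> i = f\<^sup>i 0\<close> a permutation of the residues; by construction it conjugates the shift into \<open>f\<close>.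
\<close>

lemma card_p_permutation_group_is_conjugated_shift:
  assumes p: "prime p" and C: "subgroup C (BijGroup {0..<int p})" "card C = p"
  shows "\<exists>\<sigma>. \<sigma> permutes {2..<int p} \<and> C = range (conjugated_shift p \<sigma>)"
proof -
  let ?Z = "{0..<int p}" and ?B = "BijGroup {0..<int p}"
  interpret B: group ?B
    by (rule group_BijGroup)
  have p0: "int p > 0" and p1: "int p > 1"
    using prime_gt_1_nat[OF p] by simp_all
  then have zero: "0 \<in> ?Z" and one: "1 \<in> ?Z"
    by simp_all
  have bij: "bij_betw (\<lambda>f. f 0) C ?Z"
    by (rule card_p_permutation_group_simply_transitive[OF p C zero])
  then have "1 \<in> (\<lambda>f. f 0) ` C"
    using one bij_betw_imp_surj_on by blast
  then obtain f where f: "f \<in> C" "f 0 = 1"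
    by auto
  have fB: "f \<in> Bij ?Z" and fc: "f \<in> carrier ?B"
    using subgroup.mem_carrier[OF C(1) f(1)] by (simp_all add: carrier_BijGroup)
  have fbij: "bij_betw f ?Z ?Z"
    using fB by (simp add: Bij_def)
  have "f \<noteq> \<one>\<^bsub>?B\<^esub>"
    using f(2) zero by (auto simp: BijGroup_def)
  then have gen: "C = generate ?B {f}" and ord: "B.ord f = p" and pow_p: "f [^]\<^bsub>?B\<^esub> p = \<one>\<^bsub>?B\<^esub>"
    using B.subgroup_of_prime_card[OF p C f(1)] by blast+
  have Cpow: "C = {f [^]\<^bsub>?B\<^esub> k | k. k \<in> (UNIV :: nat set)}"
    unfolding gen using B.generate_pow_nat[OF fc] ord p0 by simp
  have pow: "(f [^]\<^bsub>?B\<^esub> k) x = (f ^^ k) x" if "x \<in> ?Z" for k :: nat and x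
    by (rule BijGroup_pow_apply[OF fB that])
  have period: "(f ^^ p) x = x" if "x \<in> ?Z" for x
    using pow[OF that, of p] that unfolding pow_p by (simp add: BijGroup_def)
  have mod_period: "(f ^^ (k mod p)) 0 = (f ^^ k) 0" for k
    using funpow_mod_eq[of p f 0 k] period[OF zero] by simp
  define \<sigma> where "\<sigma> x = (if x \<in> ?Z then (f ^^ nat x) 0 else x)" for x
  have orbit: "(f ^^ k) 0 \<in> ?Z" for k
    using zero by (induction k) (auto simp: bij_betw_apply[OF fbij] simp del: atLeastLessThan_iff)
  have "?Z \<subseteq> \<sigma> ` ?Z"
  proof
    fix y assume "y \<in> ?Z"
    then have "y \<in> (\<lambda>f. f 0) ` C"
      using bij_betw_imp_surj_on[OF bij] by simp
    then obtain k where "y = (f ^^ k) 0"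
      unfolding Cpow using pow[OF zero] by auto
    then have "y = (f ^^ (k mod p)) 0"
      by (simp add: mod_period)
    also have "\<dots> = \<sigma> (int (k mod p))"
      using p0 by (simp add: \<sigma>_def)
    finally show "y \<in> \<sigma> ` ?Z"
      using p0 by auto
  qed
  moreover have "\<sigma> ` ?Z \<subseteq> ?Z"
    using orbit by (auto simp: \<sigma>_def)
  ultimately have "bij_betw \<sigma> ?Z ?Z"
    using eq_card_imp_inj_on[of ?Z \<sigma>] by (auto simp: bij_betw_def)
  then have \<sigma>Z: "\<sigma> permutes ?Z"
    by (rule bij_imp_permutes) (simp add: \<sigma>_def del: atLeastLessThan_iff)
  have \<sigma>: "\<sigma> permutes {2..<int p}"
  proof (rule permutes_superset[OF \<sigma>Z])
    fix x assume "x \<in> ?Z - {2..<int p}"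
    then have "x = 0 \<or> x = 1"
      by auto
    then show "\<sigma> x = x"
      using f(2) p1 by (auto simp: \<sigma>_def)
  qed
  have "conjugated_shift p \<sigma> 1 x = f x" if x: "x \<in> ?Z" for x
  proof -
    define j where "j = inv_into UNIV \<sigma> x"
    have j: "j \<in> ?Z" "\<sigma> j = x"
      using x permutes_in_image[OF permutes_inv[OF \<sigma>Z]] permutes_inverses(1)[OF \<sigma>Z]
      by (simp_all add: j_def)
    have "conjugated_shift p \<sigma> 1 x = \<sigma> (int (Suc (nat j) mod p))"
      using x j(1) by (simp add: conjugated_shift_def j_def[symmetric] zmod_int add.commute)
    also have "\<dots> = (f ^^ (Suc (nat j) mod p)) 0"
      using p0 by (simp add: \<sigma>_def)
    also have "\<dots> = (f ^^ Suc (nat j)) 0"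
      by (rule mod_period)
    also have "\<dots> = f x"
      using j by (simp add: \<sigma>_def)
    finally show ?thesis .
  qed
  then have shift_1: "conjugated_shift p \<sigma> 1 = f"
    using fB by (intro extensionalityI[of _ ?Z]) (auto simp: conjugated_shift_def Bij_def)
  have shift: "conjugated_shift p \<sigma> (int k) \<in> C" for k
  proof (induction k)
    case 0
    have "\<one>\<^bsub>?B\<^esub> = conjugated_shift p \<sigma> 0"
      by (simp add: BijGroup_def conjugated_shift_0[OF p \<sigma>])
    then show ?case
      using subgroup.one_closed[OF C(1)] by simp
  next
    case (Suc k)
    have "conjugated_shift p \<sigma> (int (Suc k)) = f \<otimes>\<^bsub>?B\<^esub> conjugated_shift p \<sigma> (int k)"
      using conjugated_shift_compose[OF p \<sigma>, of 1 "int k"]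
      by (simp add: shift_1 BijGroup_mult fB conjugated_shift_Bij[OF p \<sigma>])
    then show ?case
      using subgroup.m_closed[OF C(1) f(1) Suc] by simp
  qed
  have "range (conjugated_shift p \<sigma>) \<subseteq> C"
  proof
    fix g assume "g \<in> range (conjugated_shift p \<sigma>)"
    then obtain i where "g = conjugated_shift p \<sigma> (i mod int p)"
      using conjugated_shift_mod[OF p \<sigma>] by auto
    then show "g \<in> C"
      using shift[of "nat (i mod int p)"] p0 by simp
  qed
  moreover have "finite C"
    using C(2) prime_gt_0_nat[OF p] by (intro card_ge_0_finite) simp
  ultimately have "range (conjugated_shift p \<sigma>) = C"
    using card_range_conjugated_shift[OF p \<sigma>] C(2) by (intro card_subset_eq) simp_all
  then show ?thesis
    using \<sigma> by blast
qed

lemma card_order_p_cyclic_subgroups: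
  assumes p: "prime p"
  shows "card (order_p_cyclic_subgroups p) = fact (p - 2)"
proof -
  have "order_p_cyclic_subgroups p =
      (\<lambda>\<sigma>. range (conjugated_shift p \<sigma>)) ` {\<sigma>. \<sigma> permutes {2..<int p}}"
    unfolding order_p_cyclic_subgroups_eq[OF p]
  proof (intro equalityI subsetI)
    fix C assume "C \<in> {C. subgroup C (BijGroup {0..<int p}) \<and> card C = p}"
    then show "C \<in> (\<lambda>\<sigma>. range (conjugated_shift p \<sigma>)) ` {\<sigma>. \<sigma> permutes {2..<int p}}"
      using card_p_permutation_group_is_conjugated_shift[OF p] by blast
  next
    fix C assume "C \<in> (\<lambda>\<sigma>. range (conjugated_shift p \<sigma>)) ` {\<sigma>. \<sigma> permutes {2..<int p}}"
    then show "C \<in> {C. subgroup C (BijGroup {0..<int p}) \<and> card C = p}"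
      using subgroup_range_conjugated_shift[OF p] card_range_conjugated_shift[OF p] by blast
  qed
  then have "card (order_p_cyclic_subgroups p) = card {\<sigma>. \<sigma> permutes {2..<int p}}"
    using card_image[OF inj_on_range_conjugated_shift[OF p]] by simp
  also have "\<dots> = fact (p - 2)"
    by (rule card_permutations) auto
  finally show ?thesis .
qed

section \<open>The Sylow subgroups of the group of pairs\<close>

text \<open>
  There is one choice at \<open>0\<close> and there are \<open>p - 1\<close> choices at each of the other \<open>p - 1\<close> residues.
\<close>

lemma card_normalised_nonzero_maps:
  assumes p: "prime p"
  shows "card {\<phi> \<in> nonzero_maps p. \<phi> 0 = 1} = (p - 1) ^ (p - 1)"
proof -
  let ?A = "\<lambda>x :: int. if x = 0 then {1} else {0<..<int p}"
  have p1: "int p > 1"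
    using prime_gt_1_nat[OF p] by simp
  have "{\<phi> \<in> nonzero_maps p. \<phi> 0 = 1} = (\<Pi>\<^sub>E x\<in>{0..<int p}. ?A x)" (is "?L = ?R")
  proof
    show "?L \<subseteq> ?R"
    proof
      fix \<phi> assume "\<phi> \<in> ?L"
      then have \<phi>: "\<phi> \<in> {0..<int p} \<rightarrow>\<^sub>E {0<..<int p}" and \<phi>0: "\<phi> 0 = 1"
        by (simp_all add: nonzero_maps_iff)
      show "\<phi> \<in> ?R"
      proof (rule PiE_I)
        fix x assume "x \<in> {0..<int p}"
        from PiE_mem[OF \<phi> this] show "\<phi> x \<in> ?A x"
          using \<phi>0 by simp
      qed (rule PiE_arb[OF \<phi>])
    qed
    show "?R \<subseteq> ?L"
    proof
      fix \<phi> assume \<phi>: "\<phi> \<in> ?R"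
      have "\<phi> \<in> {0..<int p} \<rightarrow>\<^sub>E {0<..<int p}"
      proof (rule PiE_I)
        fix x assume "x \<in> {0..<int p}"
        from PiE_mem[OF \<phi> this] show "\<phi> x \<in> {0<..<int p}"
          using p1 by (cases "x = 0") simp_all
      qed (rule PiE_arb[OF \<phi>])
      moreover have "\<phi> 0 = 1"
        using p1 PiE_mem[OF \<phi>, of 0] by simp
      ultimately show "\<phi> \<in> ?L"
        by (simp add: nonzero_maps_iff)
    qed
  qed
  then have "card {\<phi> \<in> nonzero_maps p. \<phi> 0 = 1} = (\<Prod>x\<in>{0..<int p}. card (?A x))"
    by (simp add: card_PiE)
  also have "\<dots> = card (?A 0) * (\<Prod>x\<in>{0..<int p} - {0}. card (?A x))"
    using p1 by (intro prod.remove) auto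
  also have "(\<Prod>x\<in>{0..<int p} - {0}. card (?A x)) = (\<Prod>x\<in>{0..<int p} - {0}. p - 1)"
    by (rule prod.cong) (auto simp: nat_diff_distrib)
  also have "\<dots> = (p - 1) ^ (p - 1)"
    using p1 by simp
  finally show ?thesis
    by simp
qed

lemma sylow_subgroups_pair_group:
  assumes p: "prime p"
  shows "{S. sylow_subgroup p (pair_group p) S} =
    (\<lambda>(C, \<phi>). cocycle_subgroup p C \<phi>) ` (order_p_cyclic_subgroups p \<times> {\<phi> \<in> nonzero_maps p. \<phi> 0 = 1})"
      (is "_ = ?N")
    and "C \<in> order_p_cyclic_subgroups p \<Longrightarrow> \<phi> \<in> nonzero_maps p \<Longrightarrow>
      sylow_subgroup p (pair_group p) (cocycle_subgroup p C \<phi>)"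
proof -
  have card_p: "subgroup (cocycle_subgroup p C \<phi>) (pair_group p) \<and> card (cocycle_subgroup p C \<phi>) = p"
    if "C \<in> order_p_cyclic_subgroups p" "\<phi> \<in> nonzero_maps p" for C \<phi>
    using that subgroup_cocycle_subgroup[OF p] card_cocycle_subgroup[OF p]
    by (simp add: order_p_cyclic_subgroups_eq[OF p])
  have "card (order_p_cyclic_subgroups p) \<noteq> 0"
    by (simp add: card_order_p_cyclic_subgroups[OF p])
  then obtain C where C: "C \<in> order_p_cyclic_subgroups p"
    by (metis card.empty ex_in_conv)
  have "(\<lambda>x\<in>{0..<int p}. 1) \<in> nonzero_maps p"
    using prime_gt_1_nat[OF p] by (auto simp: nonzero_maps_iff)
  then have iff: "sylow_subgroup p (pair_group p) P \<longleftrightarrow> subgroup P (pair_group p) \<and> card P = p" for P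
    using sylow_subgroup_pair_group_iff[OF p] card_p[OF C] by blast
  show "sylow_subgroup p (pair_group p) (cocycle_subgroup p C \<phi>)"
    if "C \<in> order_p_cyclic_subgroups p" "\<phi> \<in> nonzero_maps p" for C \<phi>
    using iff card_p[OF that] by blast
  show "{S. sylow_subgroup p (pair_group p) S} = ?N"
  proof
    show "{S. sylow_subgroup p (pair_group p) S} \<subseteq> ?N"
    proof
      fix P assume "P \<in> {S. sylow_subgroup p (pair_group p) S}"
      then have "subgroup P (pair_group p)" "card P = p"
        using iff by blast+
      from card_p_subgroup_is_cocycle_subgroup[OF p this] obtain C \<phi>
        where "subgroup C (BijGroup {0..<int p})" "card C = p" "\<phi> \<in> nonzero_maps p" "\<phi> 0 = 1"
          "P = cocycle_subgroup p C \<phi>" .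
      then show "P \<in> ?N"
        by (auto simp: order_p_cyclic_subgroups_eq[OF p])
    qed
    show "?N \<subseteq> {S. sylow_subgroup p (pair_group p) S}"
      using iff card_p by auto
  qed
qed

lemma card_sylow_subgroups_pair_group:
  assumes p: "prime p"
  shows "card {S. sylow_subgroup p (pair_group p) S} = fact (p - 1) * (p - 1) ^ (p - 2)"
proof -
  have "inj_on (\<lambda>(C, \<phi>). cocycle_subgroup p C \<phi>)
      (order_p_cyclic_subgroups p \<times> {\<phi> \<in> nonzero_maps p. \<phi> 0 = 1})"
    using cocycle_subgroup_inject[OF p]
    by (auto simp: inj_on_def order_p_cyclic_subgroups_eq[OF p])
  then have "card {S. sylow_subgroup p (pair_group p) S} = fact (p - 2) * (p - 1) ^ (p - 1)"
    by (simp add: sylow_subgroups_pair_group(1)[OF p] card_image card_cartesian_product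
        card_order_p_cyclic_subgroups[OF p] card_normalised_nonzero_maps[OF p])
  moreover obtain m where m: "p = Suc (Suc m)"
    using prime_gt_1_nat[OF p] by (metis Suc_1 less_eq_Suc_le le_iff_add add_Suc One_nat_def plus_1_eq_Suc)
  then have "fact (p - 2) * (p - 1) ^ (p - 1) = fact (p - 1) * (p - 1) ^ (p - 2)"
    by (simp add: algebra_simps)
  ultimately show ?thesis
    by simp
qed

lemma sylow_subgroups_pair_group_explicit:
  assumes p: "prime p"
  shows "{S. sylow_subgroup p (pair_group p) S} =
    {explicit_sylow p C \<Phi> | C \<Phi>.
      C \<in> order_p_cyclic_subgroups p \<and> \<Phi> \<in> nonzero_maps p // scalar_rel p}" (is "?L = ?R")
proof
  show "?L \<subseteq> ?R"
  proof
    fix S assume "S \<in> ?L"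
    then obtain C \<phi> where C: "C \<in> order_p_cyclic_subgroups p" and \<phi>: "\<phi> \<in> nonzero_maps p"
      and S: "S = cocycle_subgroup p C \<phi>"
      unfolding sylow_subgroups_pair_group(1)[OF p] by auto
    have "S = explicit_sylow p C (scalar_rel p `` {\<phi>})"
      unfolding S explicit_sylow_eq_cocycle_subgroup[OF p \<phi>] ..
    then show "S \<in> ?R"
      using C quotientI[OF \<phi>] by blast
  qed
  show "?R \<subseteq> ?L"
  proof
    fix S assume "S \<in> ?R"
    then obtain C \<Phi> where C: "C \<in> order_p_cyclic_subgroups p" and \<Phi>: "\<Phi> \<in> nonzero_maps p // scalar_rel p"
      and S: "S = explicit_sylow p C \<Phi>"
      by blast
    then obtain \<phi> where \<phi>: "\<phi> \<in> nonzero_maps p" and "\<Phi> = scalar_rel p `` {\<phi>}"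
      by (auto elim: quotientE)
    then have "S = cocycle_subgroup p C \<phi>"
      by (simp add: S explicit_sylow_eq_cocycle_subgroup[OF p])
    then show "S \<in> ?L"
      using sylow_subgroups_pair_group(2)[OF p C \<phi>] by simp
  qed
qed

theorem theorem5p1:
  fixes p :: nat
  assumes "prime p"
  shows
    "(\<forall>n\<ge>2.
        card {P. sylow_subgroup p (poly_perm_group p n) P} = fact (p - 1) * (p - 1) ^ (p - 2) \<and>
        {P. sylow_subgroup p (poly_perm_group p n) P} =
          (\<lambda>S. {F \<in> carrier (poly_perm_group p n). proj_pair p n F \<in> S})
            ` {S. sylow_subgroup p (pair_group p) S})
     \<and>
     (card {P. limit_sylow_subgroup p P} = fact (p - 1) * (p - 1) ^ (p - 2) \<and>
      {P. limit_sylow_subgroup p P} =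
        (\<lambda>S. {z \<in> carrier (limit_group p). limit_proj_pair z \<in> S})
          ` {S. sylow_subgroup p (pair_group p) S})
     \<and>
     {S. sylow_subgroup p (pair_group p) S} =
       {explicit_sylow p C \<Phi> | C \<Phi>.
          C \<in> order_p_cyclic_subgroups p \<and> \<Phi> \<in> nonzero_maps p // scalar_rel p}"
proof (intro conjI allI impI)
  note count = card_sylow_subgroups_pair_group[OF assms]
  show "card {P. sylow_subgroup p (poly_perm_group p n) P} = fact (p - 1) * (p - 1) ^ (p - 2)"
    if "n \<ge> 2" for n
    unfolding sylow_subgroups_poly_perm_group(1)[OF assms that]
      card_image[OF sylow_subgroups_poly_perm_group(2)[OF assms that]] by (rule count)
  show "card {P. limit_sylow_subgroup p P} = fact (p - 1) * (p - 1) ^ (p - 2)"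
    unfolding limit_sylow_subgroups(1)[OF assms] card_image[OF limit_sylow_subgroups(2)[OF assms]]
    by (rule count)
qed (rule sylow_subgroups_poly_perm_group(1)[OF assms] limit_sylow_subgroups(1)[OF assms]
      sylow_subgroups_pair_group_explicit[OF assms]; assumption?)+

end
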